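(* Let $\Theta_{\kappa_0}$ be an L-system (with one-dimensional input-output space $\mathbb C$ and $J=1$), with symmetric operator $\dot A$, such that its impedance function $V_{\Theta_{\kappa_0}}(z)$ belongs to the class $\mathfrak M_{\kappa_0}^{-1}$. Then for any real number $Q\neq0$ there exists another L-system $\Theta^Q_\kappa$ with the same symmetric operator $\dot A$ as in $\Theta_{\kappa_0}$ and such that $$V_{\Theta^Q_\kappa}(z)=Q+V_{\Theta_{\kappa_0}}(z).$$ Moreover, with $a=\frac{1+\kappa_0}{1-\kappa_0}$ and $b=Q^2+a^2-1$, the von Neumann parameter $\kappa=\kappa(Q)$ of its main operator $T^Q$ is $$\kappa=\frac{a\left(b+\sqrt{b^2+4Q^2}\right)^2-\left(b-2Q^2+\sqrt{b^2+4Q^2}\right)^2-4Q^2a(a-1)}{\left(b-2Q^2+\sqrt{b^2+4Q^2}\right)^2+a\left(b+\sqrt{b^2+4Q^2}\right)^2+4Q^2a(a+1)},$$ while the quasi-kernel $\hat A^Q$ of $\mathrm{Re}\,\mathbb A^Q$ of the L-system $\Theta^Q_\kappa$ has von Neumann parameter $$U=\frac{(a+Qi)(1-\kappa^2)-1-\kappa^2}{2\kappa}.$$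
   Context: Class $\mathfrak M_{\kappa_0}^{-1}$ ($0\le\kappa_0<1$): functions $M(z)=\int_{\mathbb R}\left(\frac{1}{\lambda-z}-\frac{\lambda}{1+\lambda^2}\right)d\mu(\lambda)$ with $\mu$ an infinite Borel measure and $\int_{\mathbb R}\frac{d\mu(\lambda)}{1+\lambda^2}=\frac{1+\kappa_0}{1-\kappa_0}$. Rigged space: for a closed densely defined prime symmetric operator $\dot A$ with deficiency indices $(1,1)$ in a complex Hilbert space $\mathcal H$, let $\mathcal H_+=\mathrm{Dom}(\dot A^* )$ with $(f,g)_+=(f,g)+(\dot A^*f,\dot A^*g)$, and let $\mathcal H_+\subset\mathcal H\subset\mathcal H_-$ be the associated rigged Hilbert space. $[X,Y]$ denotes bounded linear operators. If $\mathbb A\in[\mathcal H_+,\mathcal H_-]$ then $\mathbb A^*\in[\mathcal H_+,\mathcal H_-]$; $\mathrm{Re}\,\mathbb A=(\mathbb A+\mathbb A^* )/2$, $\mathrm{Im}\,\mathbb A=(\mathbb A-\mathbb A^* )/2i$. The quasi-kernel $\hat A$ of $\mathrm{Re}\,\mathbb A$ is its restriction to $\{f\in\mathcal H_+:\mathrm{Re}\,\mathbb A f\in\mathcal H\}$. L-system: let $T$ be a non-symmetric operator with $\dot A\subset T\subset\dot A^*$, $\rho(T)\ne\emptyset$, $\mathrm{Dom}(\dot A)=\mathrm{Dom}(T)\cap\mathrm{Dom}(T^* )$. A $( * )$-extension of $T$ is $\mathbb A\in[\mathcal H_+,\mathcal H_-]$ with $\dot A\subset T\subset\mathbb A$, $\dot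 A\subset T^*\subset\mathbb A^*$ such that the quasi-kernel $\hat A$ of $\mathrm{Re}\,\mathbb A$ is self-adjoint in $\mathcal H$. An L-system is $\Theta=\begin{pmatrix}\mathbb A&K&1\\ \mathcal H_+\subset\mathcal H\subset\mathcal H_-&&\mathbb C\end{pmatrix}$ where $\mathbb A$ is a $( * )$-extension of such a $T$ (main operator), $K\in[\mathbb C,\mathcal H_-]$, $\mathrm{Im}\,\mathbb A=KK^*$, $\mathrm{Ran}(K)=\mathrm{Ran}(\mathrm{Im}\,\mathbb A)$. Impedance function: $V_\Theta(z)=K^*(\mathrm{Re}\,\mathbb A-zI)^{-1}K$, $z\in\rho(\hat A)$. Parameters: for normalized $g_\pm\in\mathrm{Ker}(\dot A^*\mp iI)$, the von Neumann parameter $\kappa$ of $T$ is defined by $g_+-\kappa g_-\in\mathrm{Dom}(T)$, $|\kappa|<1$; $g_\pm$ are chosen (changing the phase of $g_-$) so that $0\le\kappa<1$. The parameter $U$ ($|U|=1$) of $\hat A$ is defined, with respect to the same pair, by $g_++Ug_-\in\mathrm{Dom}(\hat A)$. *)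

theory Defs
  imports "HOL-Analysis.Analysis"
begin

section \<open>Complex Hilbert spaces\<close>

text \<open>
  The inner product is linear in the first argument. Its real part is the real inner product
  of the underlying real Hilbert space, so that the norm is the usual one and positive
  definiteness is inherited from \<^class>\<open>real_inner\<close>.
\<close>

class complex_hilbert_space = real_inner + complete_space +
  fixes scaleC :: "complex \<Rightarrow> 'a \<Rightarrow> 'a" (infixr "*\<^sub>C" 75)
    and cinner :: "'a \<Rightarrow> 'a \<Rightarrow> complex"
  assumes scaleC_add_right: "c *\<^sub>C (x + y) = c *\<^sub>C x + c *\<^sub>C y"
    and scaleC_add_left: "(c + d) *\<^sub>C x = c *\<^sub>C x + d *\<^sub>C x"
    and scaleC_scaleC: "c *\<^sub>C d *\<^sub>C x = (c * d) *\<^sub>C x"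
    and scaleC_of_real: "complex_of_real r *\<^sub>C x = r *\<^sub>R x"
    and cinner_commute: "cinner x y = cnj (cinner y x)"
    and cinner_add_left: "cinner (x + y) z = cinner x z + cinner y z"
    and cinner_scaleC_left: "cinner (c *\<^sub>C x) y = c * cinner x y"
    and inner_eq_Re_cinner: "inner x y = Re (cinner x y)"

global_interpretation cvec:
  vector_space "scaleC :: complex \<Rightarrow> 'a \<Rightarrow> 'a::complex_hilbert_space"
proof
  fix x :: 'a
  show "1 *\<^sub>C x = x"
    using scaleC_of_real[of 1 x] by simp
qed (simp_all add: scaleC_add_right scaleC_add_left scaleC_scaleC)


section \<open>Unbounded operators, represented by their graphs\<close>

definition lin_operator :: "('h::complex_hilbert_space \<times> 'h) set \<Rightarrow> bool" where
  "lin_operator A \<longleftrightarrow>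
     (0, 0) \<in> A \<and>
     (\<forall>f f' g g'. (f, f') \<in> A \<longrightarrow> (g, g') \<in> A \<longrightarrow> (f + g, f' + g') \<in> A) \<and>
     (\<forall>c f f'. (f, f') \<in> A \<longrightarrow> (c *\<^sub>C f, c *\<^sub>C f') \<in> A) \<and>
     single_valued A"

definition op_apply :: "('h \<times> 'h) set \<Rightarrow> 'h \<Rightarrow> 'h" where
  "op_apply A f = (THE f'. (f, f') \<in> A)"

text \<open>The adjoint and self-adjointness relative to a closed subspace \<open>M\<close>, for \<open>A\<close> acting in \<open>M\<close>.\<close>

definition adj_op_in :: "'h::complex_hilbert_space set \<Rightarrow> ('h \<times> 'h) set \<Rightarrow> ('h \<times> 'h) set" where
  "adj_op_in M A =
     {(g, g'). g \<in> M \<and> g' \<in> M \<and> (\<forall>(f, f') \<in> A. cinner f' g = cinner f g')}"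

definition self_adjoint_in :: "'h::complex_hilbert_space set \<Rightarrow> ('h \<times> 'h) set \<Rightarrow> bool" where
  "self_adjoint_in M A \<longleftrightarrow>
     lin_operator A \<and> A \<subseteq> M \<times> M \<and> M \<subseteq> closure (Domain A) \<and> adj_op_in M A = A"

abbreviation adj_op :: "('h::complex_hilbert_space \<times> 'h) set \<Rightarrow> ('h \<times> 'h) set" where
  "adj_op \<equiv> adj_op_in UNIV"

abbreviation self_adjoint :: "('h::complex_hilbert_space \<times> 'h) set \<Rightarrow> bool" where
  "self_adjoint \<equiv> self_adjoint_in UNIV"

definition symmetric_op :: "('h::complex_hilbert_space \<times> 'h) set \<Rightarrow> bool" where
  "symmetric_op A \<longleftrightarrow> lin_operator A \<and> closure (Domain A) = UNIV \<and> A \<subseteq> adj_op A"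

text \<open>
  A symmetric operator is prime if it has no self-adjoint part in a nonzero closed subspace.
  Since \<open>A\<close> is symmetric, a subspace \<open>M\<close> in which \<open>A \<inter> (M \<times> M)\<close> is self-adjoint automatically
  reduces \<open>A\<close>.
\<close>

definition prime_op :: "('h::complex_hilbert_space \<times> 'h) set \<Rightarrow> bool" where
  "prime_op A \<longleftrightarrow>
     \<not> (\<exists>M. cvec.subspace M \<and> closed M \<and> M \<noteq> {0} \<and> self_adjoint_in M (A \<inter> (M \<times> M)))"

definition ker_shift :: "('h::complex_hilbert_space \<times> 'h) set \<Rightarrow> complex \<Rightarrow> 'h set" where
  "ker_shift B z = {f. (f, z *\<^sub>C f) \<in> B}"

definition deficiency_indices_1_1 :: "('h::complex_hilbert_space \<times> 'h) set \<Rightarrow> bool" where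
  "deficiency_indices_1_1 A \<longleftrightarrow>
     cvec.dim (ker_shift (adj_op A) \<i>) = 1 \<and> cvec.dim (ker_shift (adj_op A) (- \<i>)) = 1"

text \<open>
  The estimate contains the injectivity of \<open>A - z\<close> and the boundedness of its inverse.
\<close>

definition resolvent_set :: "('h::complex_hilbert_space \<times> 'h) set \<Rightarrow> complex set" where
  "resolvent_set A =
     {z. (\<forall>h. \<exists>(f, f') \<in> A. f' - z *\<^sub>C f = h) \<and>
         (\<exists>C. \<forall>(f, f') \<in> A. norm f \<le> C * norm (f' - z *\<^sub>C f))}"


section \<open>The rigged Hilbert space of a symmetric operator\<close>

definition Hplus :: "('h::complex_hilbert_space \<times> 'h) set \<Rightarrow> 'h set" where
  "Hplus S = Domain (adj_op S)"

definition plus_inner :: "('h::complex_hilbert_space \<times> 'h) set \<Rightarrow> 'h \<Rightarrow> 'h \<Rightarrow> complex" where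
  "plus_inner S f g = cinner f g + cinner (op_apply (adj_op S) f) (op_apply (adj_op S) g)"

definition plus_norm :: "('h::complex_hilbert_space \<times> 'h) set \<Rightarrow> 'h \<Rightarrow> real" where
  "plus_norm S f = sqrt (Re (plus_inner S f f))"

text \<open>
  The space \<open>\<H>\<^sub>-\<close> consists of the bounded antilinear functionals on \<open>\<H>\<^sub>+\<close>; the value \<open>\<phi> h\<close> is the
  pairing \<open>(\<phi>, h)\<close>. Functionals are set to \<open>0\<close> off \<open>\<H>\<^sub>+\<close>, so that equality of functions is equality
  in \<open>\<H>\<^sub>-\<close>.
\<close>

definition Hminus :: "('h::complex_hilbert_space \<times> 'h) set \<Rightarrow> ('h \<Rightarrow> complex) set" where
  "Hminus S =
     {\<phi>. (\<forall>h. h \<notin> Hplus S \<longrightarrow> \<phi> h = 0) \<and>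
         (\<forall>h\<in>Hplus S. \<forall>k\<in>Hplus S. \<phi> (h + k) = \<phi> h + \<phi> k) \<and>
         (\<forall>c. \<forall>h\<in>Hplus S. \<phi> (c *\<^sub>C h) = cnj c * \<phi> h) \<and>
         (\<exists>C. \<forall>h\<in>Hplus S. cmod (\<phi> h) \<le> C * plus_norm S h)}"

text \<open>The inclusion of \<open>\<H>\<close> (and hence of \<open>\<H>\<^sub>+\<close>) in \<open>\<H>\<^sub>-\<close>.\<close>

definition embed :: "('h::complex_hilbert_space \<times> 'h) set \<Rightarrow> 'h \<Rightarrow> 'h \<Rightarrow> complex" where
  "embed S f = (\<lambda>h. if h \<in> Hplus S then cinner f h else 0)"

text \<open>
  Elements of \<open>[\<H>\<^sub>+, \<H>\<^sub>-]\<close>. The last clause is \<open>\<parallel>\<A> f\<parallel>\<^sub>- \<le> C \<parallel>f\<parallel>\<^sub>+\<close>, the norm of \<open>\<H>\<^sub>-\<close> being the norm of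
  a functional on \<open>\<H>\<^sub>+\<close>. Only the values on \<open>\<H>\<^sub>+\<close> are relevant.
\<close>

definition bounded_plus_minus ::
    "('h::complex_hilbert_space \<times> 'h) set \<Rightarrow> ('h \<Rightarrow> 'h \<Rightarrow> complex) \<Rightarrow> bool" where
  "bounded_plus_minus S A \<longleftrightarrow>
     (\<forall>f\<in>Hplus S. A f \<in> Hminus S) \<and>
     (\<forall>f\<in>Hplus S. \<forall>g\<in>Hplus S. \<forall>h. A (f + g) h = A f h + A g h) \<and>
     (\<forall>c. \<forall>f\<in>Hplus S. \<forall>h. A (c *\<^sub>C f) h = c * A f h) \<and>
     (\<exists>C. \<forall>f\<in>Hplus S. \<forall>h\<in>Hplus S. cmod (A f h) \<le> C * plus_norm S f * plus_norm S h)"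

text \<open>The adjoint is determined by \<open>(\<A>\<^sup>* f, h) = cnj (\<A> h, f)\<close> for \<open>f, h\<close> in \<open>\<H>\<^sub>+\<close>.\<close>

definition adj_pm ::
    "('h::complex_hilbert_space \<times> 'h) set \<Rightarrow> ('h \<Rightarrow> 'h \<Rightarrow> complex) \<Rightarrow> 'h \<Rightarrow> 'h \<Rightarrow> complex" where
  "adj_pm S A f = (\<lambda>h. if h \<in> Hplus S then cnj (A h f) else 0)"

definition Re_pm ::
    "('h::complex_hilbert_space \<times> 'h) set \<Rightarrow> ('h \<Rightarrow> 'h \<Rightarrow> complex) \<Rightarrow> 'h \<Rightarrow> 'h \<Rightarrow> complex" where
  "Re_pm S A f = (\<lambda>h. (A f h + adj_pm S A f h) / 2)"

definition Im_pm ::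
    "('h::complex_hilbert_space \<times> 'h) set \<Rightarrow> ('h \<Rightarrow> 'h \<Rightarrow> complex) \<Rightarrow> 'h \<Rightarrow> 'h \<Rightarrow> complex" where
  "Im_pm S A f = (\<lambda>h. (A f h - adj_pm S A f h) / (2 * \<i>))"

definition quasi_kernel_pm ::
    "('h::complex_hilbert_space \<times> 'h) set \<Rightarrow> ('h \<Rightarrow> 'h \<Rightarrow> complex) \<Rightarrow> ('h \<times> 'h) set" where
  "quasi_kernel_pm S B = {(f, g). f \<in> Hplus S \<and> B f = embed S g}"


section \<open>L-systems with input-output space \<open>\<complex>\<close> and \<open>J = 1\<close>\<close>

record 'h l_system =
  sym_op :: "('h \<times> 'h) set"
  main_op :: "('h \<times> 'h) set"
  state_op :: "'h \<Rightarrow> 'h \<Rightarrow> complex"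
  channel_op :: "complex \<Rightarrow> 'h \<Rightarrow> complex"

definition admissible_symmetric :: "('h::complex_hilbert_space \<times> 'h) set \<Rightarrow> bool" where
  "admissible_symmetric S \<longleftrightarrow>
     symmetric_op S \<and> closed S \<and> prime_op S \<and> deficiency_indices_1_1 S"

definition admissible_main ::
    "('h::complex_hilbert_space \<times> 'h) set \<Rightarrow> ('h \<times> 'h) set \<Rightarrow> bool" where
  "admissible_main S T \<longleftrightarrow>
     lin_operator T \<and> \<not> symmetric_op T \<and> S \<subseteq> T \<and> T \<subseteq> adj_op S \<and>
     resolvent_set T \<noteq> {} \<and> Domain S = Domain T \<inter> Domain (adj_op T)"

definition star_extension ::
    "('h::complex_hilbert_space \<times> 'h) set \<Rightarrow> ('h \<times> 'h) set \<Rightarrow> ('h \<Rightarrow> 'h \<Rightarrow> complex) \<Rightarrow> bool" where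
  "star_extension S T A \<longleftrightarrow>
     bounded_plus_minus S A \<and>
     S \<subseteq> T \<and> (\<forall>(f, f') \<in> T. A f = embed S f') \<and>
     S \<subseteq> adj_op T \<and> (\<forall>(f, f') \<in> adj_op T. adj_pm S A f = embed S f') \<and>
     self_adjoint (quasi_kernel_pm S (Re_pm S A))"

text \<open>Elements of \<open>[\<complex>, \<H>\<^sub>-]\<close>; boundedness is automatic.\<close>

definition linear_C_minus ::
    "('h::complex_hilbert_space \<times> 'h) set \<Rightarrow> (complex \<Rightarrow> 'h \<Rightarrow> complex) \<Rightarrow> bool" where
  "linear_C_minus S K \<longleftrightarrow>
     (\<forall>c. K c \<in> Hminus S) \<and>
     (\<forall>c d h. K (c + d) h = K c h + K d h) \<and>
     (\<forall>c d h. K (c * d) h = c * K d h)"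

text \<open>The adjoint in \<open>[\<H>\<^sub>+, \<complex>]\<close> is determined by \<open>(K c, f) = c * cnj (K\<^sup>* f)\<close>.\<close>

definition adj_K :: "(complex \<Rightarrow> 'h \<Rightarrow> complex) \<Rightarrow> 'h \<Rightarrow> complex" where
  "adj_K K f = cnj (K 1 f)"

definition is_l_system :: "'h::complex_hilbert_space l_system \<Rightarrow> bool" where
  "is_l_system \<Theta> \<longleftrightarrow>
     admissible_symmetric (sym_op \<Theta>) \<and>
     admissible_main (sym_op \<Theta>) (main_op \<Theta>) \<and>
     star_extension (sym_op \<Theta>) (main_op \<Theta>) (state_op \<Theta>) \<and>
     linear_C_minus (sym_op \<Theta>) (channel_op \<Theta>) \<and>
     (\<forall>f\<in>Hplus (sym_op \<Theta>).
        Im_pm (sym_op \<Theta>) (state_op \<Theta>) f = channel_op \<Theta> (adj_K (channel_op \<Theta>) f)) \<and>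
     range (channel_op \<Theta>) = Im_pm (sym_op \<Theta>) (state_op \<Theta>) ` Hplus (sym_op \<Theta>)"

definition quasi_kernel :: "'h::complex_hilbert_space l_system \<Rightarrow> ('h \<times> 'h) set" where
  "quasi_kernel \<Theta> = quasi_kernel_pm (sym_op \<Theta>) (Re_pm (sym_op \<Theta>) (state_op \<Theta>))"

text \<open>
  The linear map \<open>K\<^sup>* (Re \<A> - z I)\<^sup>-\<^sup>1 K\<close> of \<open>\<complex>\<close> is identified with its value at \<open>1\<close>. It is
  meaningful for \<open>z\<close> in the resolvent set of the quasi-kernel.
\<close>

definition impedance :: "'h::complex_hilbert_space l_system \<Rightarrow> complex \<Rightarrow> complex" where
  "impedance \<Theta> z =
     adj_K (channel_op \<Theta>)
       (inv_into (Hplus (sym_op \<Theta>))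
          (\<lambda>f h. Re_pm (sym_op \<Theta>) (state_op \<Theta>) f h - z * embed (sym_op \<Theta>) f h)
          (channel_op \<Theta> 1))"


section \<open>The function classes and the von Neumann parameters\<close>

text \<open>
  Membership of \<open>M\<close> only concerns its values off the real axis.
\<close>

definition class_M_inv :: "real \<Rightarrow> (complex \<Rightarrow> complex) set" where
  "class_M_inv \<kappa>0 =
     {M. \<exists>\<mu> :: real measure.
           sets \<mu> = sets borel \<and> emeasure \<mu> UNIV = \<infinity> \<and>
           (\<integral>\<^sup>+ t. ennreal (1 / (1 + t\<^sup>2)) \<partial>\<mu>) = ennreal ((1 + \<kappa>0) / (1 - \<kappa>0)) \<and>
           (\<forall>z. Im z \<noteq> 0 \<longrightarrow>
              M z = (\<integral>t. 1 / (complex_of_real t - z) - complex_of_real (t / (1 + t\<^sup>2)) \<partial>\<mu>))}"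

definition normalized_pair :: "('h::complex_hilbert_space \<times> 'h) set \<Rightarrow> 'h \<Rightarrow> 'h \<Rightarrow> bool" where
  "normalized_pair S gp gm \<longleftrightarrow>
     gp \<in> ker_shift (adj_op S) \<i> \<and> gm \<in> ker_shift (adj_op S) (- \<i>) \<and> norm gp = 1 \<and> norm gm = 1"

definition main_parameter ::
    "('h::complex_hilbert_space \<times> 'h) set \<Rightarrow> 'h \<Rightarrow> 'h \<Rightarrow> complex \<Rightarrow> bool" where
  "main_parameter T gp gm \<kappa> \<longleftrightarrow> cmod \<kappa> < 1 \<and> gp - \<kappa> *\<^sub>C gm \<in> Domain T"

definition self_adjoint_parameter ::
    "('h::complex_hilbert_space \<times> 'h) set \<Rightarrow> 'h \<Rightarrow> 'h \<Rightarrow> complex \<Rightarrow> bool" where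
  "self_adjoint_parameter A gp gm U \<longleftrightarrow> cmod U = 1 \<and> gp + U *\<^sub>C gm \<in> Domain A"

text \<open>
  A normalized pair for which the von Neumann parameter of \<open>T\<close> is a number \<open>0 \<le> \<kappa> < 1\<close>. If \<open>T\<close> is the
  main operator of an L-system, every normalized pair becomes such a pair after a change of the
  phase of its second vector.
\<close>

definition adapted_pair ::
    "('h::complex_hilbert_space \<times> 'h) set \<Rightarrow> ('h \<times> 'h) set \<Rightarrow> 'h \<Rightarrow> 'h \<Rightarrow> real \<Rightarrow> bool" where
  "adapted_pair S T gp gm \<kappa> \<longleftrightarrow>
     normalized_pair S gp gm \<and> 0 \<le> \<kappa> \<and> main_parameter T gp gm (complex_of_real \<kappa>)"

end

theory Submission
  imports Defs
begin

text \<open>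
  An L-system is encoded by two functionals on \<open>\<H>\<^sub>+\<close>: \<open>\<Gamma>1 = K\<^sup>*\<close>, and \<open>\<Gamma>0\<close> defined by
  \<open>(Re \<A> f, h) = (S\<^sup>* f, h) + \<Gamma>0 f * cnj (\<Gamma>1 h)\<close>. They form a boundary triple for \<open>S\<^sup>*\<close>, the quasi-kernel
  is \<open>S\<^sup>*\<close> restricted to \<open>Ker \<Gamma>0\<close>, the main operator is \<open>S\<^sup>*\<close> restricted to \<open>Ker (\<Gamma>0 + \<i> \<Gamma>1)\<close>, and the
  impedance function is the Weyl function \<open>V(z) = \<Gamma>1 f\<close>, where \<open>S\<^sup>* f = z f\<close> and \<open>\<Gamma>0 f = 1\<close>. Replacing \<open>\<Gamma>1\<close>
  by \<open>\<Gamma>1 + Q \<Gamma>0\<close> gives another boundary triple; it adds \<open>Q\<close> to the impedance function and keeps the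
  quasi-kernel. Membership in the class enters only through \<open>V(\<i>) = \<i> a\<close>, which determines the boundary
  values of the deficiency vectors and so gives \<open>(1 - a + \<i> Q) / (1 + a + \<i> Q)\<close> for the von Neumann
  parameter, up to its phase.
\<close>

section \<open>Complex Hilbert spaces\<close>

lemma cinner_add_right: "cinner x (y + z) = cinner x y + cinner x z"
  by (metis cinner_add_left cinner_commute complex_cnj_add)

lemma cinner_scaleC_right: "cinner x (c *\<^sub>C y) = cnj c * cinner x y"
  by (metis cinner_scaleC_left cinner_commute complex_cnj_mult)

lemma cinner_zero_left [simp]: "cinner 0 x = 0"
  by (metis add_cancel_right_right cinner_add_left)

lemma cinner_zero_right [simp]: "cinner x 0 = 0"
  by (metis cinner_zero_left cinner_commute complex_cnj_zero)

lemma cinner_minus_left: "cinner (- x) y = - cinner x y"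
  by (metis add.right_inverse cinner_add_left cinner_zero_left eq_neg_iff_add_eq_0 add.commute)

lemma cinner_minus_right: "cinner x (- y) = - cinner x y"
  by (metis cinner_minus_left cinner_commute complex_cnj_minus)

lemma cinner_diff_left: "cinner (x - y) z = cinner x z - cinner y z"
  by (metis cinner_add_left cinner_minus_left uminus_add_conv_diff add.commute)

lemma cinner_diff_right: "cinner x (y - z) = cinner x y - cinner x z"
  by (metis cinner_add_right cinner_minus_right uminus_add_conv_diff add.commute)

lemmas cinner_simps = cinner_add_left cinner_add_right cinner_scaleC_left cinner_scaleC_right
  cinner_minus_left cinner_minus_right cinner_diff_left cinner_diff_right

lemma cinner_self: "cinner x x = complex_of_real ((norm x)\<^sup>2)"
proof (rule complex_eqI)
  show "Re (cinner x x) = Re (complex_of_real ((norm x)\<^sup>2))"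
    by (simp add: inner_eq_Re_cinner[symmetric] power2_norm_eq_inner)
  show "Im (cinner x x) = Im (complex_of_real ((norm x)\<^sup>2))"
    using arg_cong[OF cinner_commute[of x x], of Im] by simp
qed

lemma norm_scaleC: "norm (c *\<^sub>C x) = cmod c * norm x"
proof -
  have "complex_of_real ((norm (c *\<^sub>C x))\<^sup>2) = complex_of_real ((cmod c * norm x)\<^sup>2)"
    by (simp only: cinner_self[symmetric] cinner_scaleC_left cinner_scaleC_right power_mult_distrib
        of_real_mult complex_norm_square[of c] mult_ac)
  then have "(norm (c *\<^sub>C x))\<^sup>2 = (cmod c * norm x)\<^sup>2"
    by (simp only: of_real_eq_iff)
  then show ?thesis
    by (simp add: power2_eq_iff_nonneg)
qed

text \<open>The phase \<open>c\<close> makes the inner product real and positive without changing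
  \<open>norm x\<close>, which reduces the claim to the real Cauchy-Schwarz inequality.\<close>

lemma norm_cinner_le: "cmod (cinner x y) \<le> norm x * norm y"
proof (cases "cinner x y = 0")
  case False
  define c where "c = cnj (cinner x y) / cmod (cinner x y)"
  have c: "cmod c = 1" and "c * cinner x y = cmod (cinner x y)"
    using False complex_norm_square[of "cinner x y"]
    by (simp_all add: c_def norm_divide field_simps power2_eq_square)
  then have "cmod (cinner x y) = inner (c *\<^sub>C x) y"
    by (simp add: inner_eq_Re_cinner cinner_scaleC_left)
  also have "\<dots> \<le> norm (c *\<^sub>C x) * norm y"
    by (rule norm_cauchy_schwarz)
  finally show ?thesis by (simp add: norm_scaleC c)
qed simp

section \<open>Density, one-dimensional spaces and orthogonal projection\<close>

lemma orthogonal_dense_zero: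
  fixes x :: "'h::complex_hilbert_space"
  assumes "closure D = UNIV" and "\<And>f. f \<in> D \<Longrightarrow> cinner x f = 0"
  shows "x = 0"
proof -
  have "closed {f. inner x f = 0}"
    by (intro closed_Collect_eq continuous_intros)
  moreover have "D \<subseteq> {f. inner x f = 0}"
    using assms(2) by (auto simp: inner_eq_Re_cinner)
  ultimately have "closure D \<subseteq> {f. inner x f = 0}"
    by (rule closure_minimal[rotated])
  with assms(1) have "inner x x = 0" by blast
  then show ?thesis by simp
qed

lemma cdim_one_multiple:
  fixes V :: "'h::complex_hilbert_space set"
  assumes "cvec.dim V = 1"
  obtains v where "v \<in> V" "v \<noteq> 0" "\<And>x. x \<in> V \<Longrightarrow> \<exists>c. x = c *\<^sub>C v"
proof -
  obtain B where B: "B \<subseteq> V" "cvec.independent B" "V \<subseteq> cvec.span B" "card B = cvec.dim V"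
    by (rule cvec.basis_exists)
  with assms obtain v where v: "B = {v}"
    by (metis card_1_singletonE)
  show thesis
  proof
    show "v \<in> V" "v \<noteq> 0" using B v by auto
    show "\<exists>c. x = c *\<^sub>C v" if "x \<in> V" for x
      using that B(3) v by (auto simp: cvec.span_singleton)
  qed
qed

text \<open>A minimizing sequence is Cauchy by the parallelogram law.\<close>

lemma projection_exists:
  fixes M :: "'a::{real_inner,complete_space} set" and x :: 'a
  assumes sub: "subspace M" and cl: "closed M"
  obtains m where "m \<in> M" "\<And>y. y \<in> M \<Longrightarrow> inner (x - m) y = 0"
proof -
  have ne: "M \<noteq> {}" using sub subspace_0 by blast
  define d where "d = infdist x M"
  have d_le: "d \<le> norm (x - y)" if "y \<in> M" for y
    using infdist_le[OF that, of x] by (simp add: d_def dist_norm)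
  have d0: "0 \<le> d" by (simp add: d_def infdist_nonneg)
  have "\<exists>y\<in>M. norm (x - y) < d + 1 / Suc n" for n
  proof -
    have "(INF y\<in>M. dist x y) < d + 1 / Suc n"
      using ne by (simp add: d_def infdist_def)
    then show ?thesis
      using ne by (subst (asm) cINF_less_iff) (auto simp: dist_norm intro: bdd_belowI[of _ 0])
  qed
  then obtain Y where Y: "\<And>n. Y n \<in> M" "\<And>n. norm (x - Y n) < d + 1 / Suc n"
    by metis
  have par: "(norm (Y m - Y n))\<^sup>2 \<le> 2 * (norm (x - Y m))\<^sup>2 + 2 * (norm (x - Y n))\<^sup>2 - 4 * d\<^sup>2" for m n
  proof -
    \<comment> \<open>The midpoint of \<open>Y m\<close> and \<open>Y n\<close> stays in
      \<open>M\<close>, so its distance to \<open>x\<close> is at least \<open>d\<close>; this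
      supplies the term \<open>- 4 * d\<^sup>2\<close>.\<close>
    have "(1/2) *\<^sub>R (Y m + Y n) \<in> M"
      using Y(1) sub by (intro subspace_scale subspace_add)
    from d_le[OF this] have "4 * d\<^sup>2 \<le> 4 * (norm (x - (1/2) *\<^sub>R (Y m + Y n)))\<^sup>2"
      using d0 by (simp add: power_mono)
    also have "\<dots> = (norm ((x - Y m) + (x - Y n)))\<^sup>2"
    proof -
      have "(x - Y m) + (x - Y n) = 2 *\<^sub>R (x - (1/2) *\<^sub>R (Y m + Y n))"
        by (simp add: algebra_simps scaleR_2)
      then show ?thesis by (simp add: power_mult_distrib)
    qed
    moreover have "(norm ((x - Y m) + (x - Y n)))\<^sup>2 + (norm (Y m - Y n))\<^sup>2
        = 2 * (norm (x - Y m))\<^sup>2 + 2 * (norm (x - Y n))\<^sup>2"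
      using dot_norm[of "x - Y m" "x - Y n"] dot_norm_neg[of "x - Y m" "x - Y n"]
      by (simp add: norm_minus_commute)
    ultimately show ?thesis by linarith
  qed
  have lim: "(\<lambda>n. norm (x - Y n)) \<longlonglongrightarrow> d"
  proof (rule tendsto_sandwich[of "\<lambda>_. d" _ _ "\<lambda>n. d + 1 / Suc n"])
    show "(\<lambda>n. d + 1 / Suc n) \<longlonglongrightarrow> d"
      using tendsto_add[OF tendsto_const LIMSEQ_inverse_real_of_nat, of d]
      by (simp add: inverse_eq_divide)
    show "\<forall>\<^sub>F n in sequentially. norm (x - Y n) \<le> d + 1 / Suc n"
      using less_imp_le[OF Y(2)] by (rule always_eventually[OF allI])
  qed (use Y(1) d_le in auto)
  have "Cauchy Y"
  proof (rule CauchyI)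
    fix e :: real assume e: "0 < e"
    have "(\<lambda>n. 2 * (norm (x - Y n))\<^sup>2) \<longlonglongrightarrow> 2 * d\<^sup>2"
      by (intro tendsto_intros lim)
    then have "\<forall>\<^sub>F n in sequentially. 2 * (norm (x - Y n))\<^sup>2 < 2 * d\<^sup>2 + e\<^sup>2 / 2"
      by (rule order_tendstoD) (use e in simp)
    then obtain N where N: "\<And>n. n \<ge> N \<Longrightarrow> 2 * (norm (x - Y n))\<^sup>2 < 2 * d\<^sup>2 + e\<^sup>2 / 2"
      by (auto simp: eventually_sequentially)
    show "\<exists>N. \<forall>m\<ge>N. \<forall>n\<ge>N. norm (Y m - Y n) < e"
    proof (intro exI allI impI)
      fix m n assume "N \<le> m" "N \<le> n"
      then have "(norm (Y m - Y n))\<^sup>2 < e\<^sup>2"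
        using par[of m n] N[of m] N[of n] by simp
      then show "norm (Y m - Y n) < e"
        using e by (simp add: power2_less_imp_less)
    qed
  qed
  then obtain m where m: "Y \<longlonglongrightarrow> m"
    using Cauchy_convergent convergent_def by blast
  have mM: "m \<in> M"
    using cl Y(1) m closed_sequentially by blast
  have "(\<lambda>n. norm (x - Y n)) \<longlonglongrightarrow> norm (x - m)"
    by (intro tendsto_intros m)
  then have nm: "norm (x - m) = d"
    using lim LIMSEQ_unique by blast
  have "inner (x - m) y = 0" if y: "y \<in> M" for y
  proof (cases "y = 0")
    case False
    \<comment> \<open>Subtracting this multiple of \<open>y\<close> would shorten
      \<open>x - m\<close> as much as possible; since \<open>m\<close> is already nearest to
      \<open>x\<close>, the gain must be zero.\<close>
    define t where "t = inner (x - m) y / inner y y"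
    have "m + t *\<^sub>R y \<in> M"
      using sub mM y by (intro subspace_add subspace_scale)
    from d_le[OF this] have "(norm (x - m))\<^sup>2 \<le> (norm ((x - m) - t *\<^sub>R y))\<^sup>2"
      by (simp add: nm d0 power_mono diff_diff_eq)
    also have "\<dots> = (norm (x - m))\<^sup>2 - 2 * t * inner (x - m) y + t\<^sup>2 * inner y y"
      using dot_norm_neg[of "x - m" "t *\<^sub>R y"]
      by (simp add: power_mult_distrib power2_norm_eq_inner[of y])
    also have "\<dots> = (norm (x - m))\<^sup>2 - (inner (x - m) y)\<^sup>2 / inner y y"
      using False by (simp add: t_def power2_eq_square field_simps)
    finally have "(inner (x - m) y)\<^sup>2 / inner y y \<le> 0" by simp
    moreover have "inner y y > 0" using False by simp
    ultimately show ?thesis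
      by (simp add: divide_le_0_iff)
  qed simp
  with mM show thesis by (rule that)
qed


section \<open>Adjoints and graphs\<close>

lemma
  assumes "lin_operator A"
  shows lin_operator_zero: "(0, 0) \<in> A"
    and lin_operator_add: "(f, f') \<in> A \<Longrightarrow> (g, g') \<in> A \<Longrightarrow> (f + g, f' + g') \<in> A"
    and lin_operator_scale: "(f, f') \<in> A \<Longrightarrow> (c *\<^sub>C f, c *\<^sub>C f') \<in> A"
  using assms by (simp_all add: lin_operator_def)

lemma lin_operator_diff:
  assumes "lin_operator A" "(f, f') \<in> A" "(g, g') \<in> A"
  shows "(f - g, f' - g') \<in> A"
  using lin_operator_add[OF assms(1,2) lin_operator_scale[OF assms(1,3), of "- 1"]] by simp

lemma lin_operator_subspace:
  assumes "lin_operator A"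
  shows "subspace A"
  unfolding subspace_def
proof (intro conjI ballI allI)
  show "0 \<in> A"
    using lin_operator_zero[OF assms] by (simp add: zero_prod_def)
  show "x + y \<in> A" if "x \<in> A" "y \<in> A" for x y
    using that lin_operator_add[OF assms, of "fst x" "snd x" "fst y" "snd y"]
    by (simp add: plus_prod_def)
  show "r *\<^sub>R x \<in> A" if "x \<in> A" for r x
    using that lin_operator_scale[OF assms, of "fst x" "snd x" "complex_of_real r"]
    by (simp add: scaleR_prod_def scaleC_of_real)
qed

lemma adj_opD: "(g, g') \<in> adj_op A \<Longrightarrow> (f, f') \<in> A \<Longrightarrow> cinner f' g = cinner f g'"
  unfolding adj_op_in_def by blast

lemma adj_op_antimono: "A \<subseteq> B \<Longrightarrow> adj_op B \<subseteq> adj_op A"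
  unfolding adj_op_in_def by blast

text \<open>Replacing \<open>f\<close> by \<open>\<i> *\<^sub>C f\<close> recovers the imaginary parts.\<close>

lemma adj_op_iff_inner:
  assumes "lin_operator A"
  shows "(g, g') \<in> adj_op A \<longleftrightarrow> (\<forall>(f, f') \<in> A. inner f' g = inner f g')"
proof
  assume "(g, g') \<in> adj_op A"
  then show "\<forall>(f, f') \<in> A. inner f' g = inner f g'"
    by (auto simp: inner_eq_Re_cinner dest: adj_opD)
next
  assume *: "\<forall>(f, f') \<in> A. inner f' g = inner f g'"
  have "cinner f' g = cinner f g'" if "(f, f') \<in> A" for f f'
  proof (rule complex_eqI)
    show "Re (cinner f' g) = Re (cinner f g')"
      using * that by (auto simp: inner_eq_Re_cinner)
    have "inner (\<i> *\<^sub>C f') g = inner (\<i> *\<^sub>C f) g'"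
      using * lin_operator_scale[OF assms that, of \<i>] by auto
    then show "Im (cinner f' g) = Im (cinner f g')"
      by (simp add: inner_eq_Re_cinner cinner_scaleC_left)
  qed
  then show "(g, g') \<in> adj_op A"
    unfolding adj_op_in_def by auto
qed

lemma closed_adj_op:
  assumes "lin_operator A"
  shows "closed (adj_op A)"
proof -
  have "adj_op A = (\<Inter>p\<in>A. {q. inner (snd p) (fst q) = inner (fst p) (snd q)})"
    using adj_op_iff_inner[OF assms] by (fastforce simp: case_prod_beta)
  also have "closed \<dots>"
    by (intro closed_INT ballI closed_Collect_eq continuous_intros)
  finally show ?thesis .
qed

text \<open>The orthogonal complement of the graph of \<open>A\<close> is the rotated graph of its adjoint.\<close>

lemma graph_decomposition:
  fixes A :: "('h::complex_hilbert_space \<times> 'h) set"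
  assumes "lin_operator A" "closed A"
  obtains x x' v v' where "(x, x') \<in> A" "(v, v') \<in> adj_op A" "p = x - v'" "q = x' + v"
proof -
  obtain m where m: "m \<in> A" "\<And>y. y \<in> A \<Longrightarrow> inner ((p, q) - m) y = 0"
    using projection_exists[OF lin_operator_subspace[OF assms(1)] assms(2)] by blast
  \<comment> \<open>The projection only yields orthogonality for the real inner product, which is
    why the real criterion for the adjoint is used.\<close>
  have "(q - snd m, - (p - fst m)) \<in> adj_op A"
    unfolding adj_op_iff_inner[OF assms(1)]
  proof safe
    fix f f' assume "(f, f') \<in> A"
    from m(2)[OF this] show "inner f' (q - snd m) = inner f (- (p - fst m))"
      by (simp add: inner_prod_def inner_commute algebra_simps)
  qed
  then show thesis
    by (rule that[rotated]) (use m(1) in auto)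
qed

text \<open>A closed operator equals its second adjoint: the component of \<open>(f, f')\<close>
  orthogonal to the graph is \<open>(- v', v)\<close> with \<open>(v, v')\<close> in the adjoint,
  and testing \<open>orth\<close> on this very pair makes it vanish.\<close>

lemma biadjoint_closed:
  assumes "lin_operator A" "closed A"
    and orth: "\<And>g g'. (g, g') \<in> adj_op A \<Longrightarrow> cinner g' f = cinner g f'"
  shows "(f, f') \<in> A"
proof -
  obtain x x' v v' where d: "(x, x') \<in> A" "(v, v') \<in> adj_op A" "f = x - v'" "f' = x' + v"
    using graph_decomposition[OF assms(1,2)] by metis
  have "cinner v' x = cinner v x'"
    using adj_opD[OF d(2,1)] by (metis cinner_commute)
  with orth[OF d(2)] have "cinner v' v' + cinner v v = 0"
    by (simp add: d(3,4) cinner_simps) (metis add.right_inverse)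
  then have "complex_of_real ((norm v')\<^sup>2 + (norm v)\<^sup>2) = 0"
    by (simp only: cinner_self of_real_add)
  then have "v' = 0" "v = 0"
    by (simp_all only: of_real_eq_0_iff sum_power2_eq_zero_iff norm_eq_zero)
  with d show ?thesis by simp
qed

text \<open>Decompose \<open>(0, h)\<close> along the graph and its complement.\<close>

lemma self_adjoint_range:
  assumes "self_adjoint A" and z: "z * z = - 1"
  obtains f f' where "(f, f') \<in> A" "f' - z *\<^sub>C f = h"
proof -
  have lin: "lin_operator A" and adj: "adj_op A = A"
    using assms(1) by (auto simp: self_adjoint_in_def)
  obtain x x' v v' where d: "(x, x') \<in> A" "(v, v') \<in> A" "0 = x - v'" "h = x' + v"
    using graph_decomposition[OF lin, of 0 h] closed_adj_op[OF lin] adj by metis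
  \<comment> \<open>Because \<open>x = v'\<close>, the terms \<open>z *\<^sub>C v'\<close> and
    \<open>z *\<^sub>C x\<close> cancel below, and \<open>z * z = - 1\<close> leaves exactly
    \<open>x' + v\<close>.\<close>
  have "(x + z *\<^sub>C v, x' + z *\<^sub>C v') \<in> A"
    using d lin by (intro lin_operator_add lin_operator_scale)
  moreover have "(x' + z *\<^sub>C v') - z *\<^sub>C (x + z *\<^sub>C v) = h"
    using d z by (simp add: scaleC_add_right scaleC_scaleC)
  ultimately show thesis by (rule that)
qed

lemma adj_op_add:
  assumes "(f, f') \<in> adj_op A" "(g, g') \<in> adj_op A"
  shows "(f + g, f' + g') \<in> adj_op A"
  using assms unfolding adj_op_in_def by (fastforce simp: cinner_simps)

lemma adj_op_scale:
  assumes "(f, f') \<in> adj_op A"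
  shows "(c *\<^sub>C f, c *\<^sub>C f') \<in> adj_op A"
  using assms unfolding adj_op_in_def by (auto simp: cinner_simps)

lemma adj_op_unique:
  assumes "closure (Domain A) = UNIV" "(f, f') \<in> adj_op A" "(f, f'') \<in> adj_op A"
  shows "f' = f''"
proof -
  have "cinner (f' - f'') g = 0" if "g \<in> Domain A" for g
  proof -
    from that obtain g' where "(g, g') \<in> A" by blast
    with assms(2,3) have "cinner g f' = cinner g f''"
      by (metis adj_opD)
    then have "cinner f' g = cinner f'' g"
      by (metis cinner_commute)
    then show ?thesis by (simp add: cinner_simps)
  qed
  from orthogonal_dense_zero[OF assms(1) this] show ?thesis by simp
qed

lemma lin_operator_adj_op:
  assumes "closure (Domain A) = UNIV"
  shows "lin_operator (adj_op A)"
  unfolding lin_operator_def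
proof (intro conjI allI impI)
  show "(0, 0) \<in> adj_op A"
    by (auto simp: adj_op_in_def)
  show "single_valued (adj_op A)"
    using adj_op_unique[OF assms] by (auto simp: single_valued_def)
qed (auto intro: adj_op_add adj_op_scale)

section \<open>Boundary triples\<close>

locale symmetric_operator =
  fixes S :: "('h::complex_hilbert_space \<times> 'h) set"
  assumes symmetric: "symmetric_op S"
begin

abbreviation ast :: "'h \<Rightarrow> 'h" where "ast \<equiv> op_apply (adj_op S)"

lemma lin: "lin_operator S"
  and dense: "closure (Domain S) = UNIV"
  and sub_adj: "S \<subseteq> adj_op S"
  using symmetric by (auto simp: symmetric_op_def)

lemma ast_eqI: "(f, f') \<in> adj_op S \<Longrightarrow> ast f = f'"
  unfolding op_apply_def using adj_op_unique[OF dense] by (auto intro: the_equality)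

lemma ast_in: "f \<in> Hplus S \<Longrightarrow> (f, ast f) \<in> adj_op S"
  unfolding Hplus_def using ast_eqI by blast

lemma in_adj_iff: "(f, f') \<in> adj_op S \<longleftrightarrow> f \<in> Hplus S \<and> ast f = f'"
  using ast_eqI ast_in by (auto simp: Hplus_def)

lemma
  assumes "f \<in> Hplus S" "g \<in> Hplus S"
  shows Hplus_add: "f + g \<in> Hplus S" and ast_add: "ast (f + g) = ast f + ast g"
  using adj_op_add[OF ast_in ast_in, OF assms] by (simp_all add: in_adj_iff)

lemma
  assumes "f \<in> Hplus S"
  shows Hplus_scale: "c *\<^sub>C f \<in> Hplus S" and ast_scale: "ast (c *\<^sub>C f) = c *\<^sub>C ast f"
  using adj_op_scale[OF ast_in[OF assms]] by (simp_all add: in_adj_iff)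

lemma
  assumes "f \<in> Hplus S" "g \<in> Hplus S"
  shows Hplus_diff: "f - g \<in> Hplus S" and ast_diff: "ast (f - g) = ast f - ast g"
  using lin_operator_diff[OF lin_operator_adj_op[OF dense] ast_in ast_in, OF assms]
  by (simp_all add: in_adj_iff)

lemma ker_shift_iff: "f \<in> ker_shift (adj_op S) z \<longleftrightarrow> f \<in> Hplus S \<and> ast f = z *\<^sub>C f"
  by (simp add: ker_shift_def in_adj_iff)

lemma Domain_sub_Hplus: "Domain S \<subseteq> Hplus S"
  using sub_adj by (auto simp: Hplus_def)

lemma ast_on_S: "(f, f') \<in> S \<Longrightarrow> ast f = f'"
  using sub_adj ast_eqI by blast

lemma ast_S_cinner: "f \<in> Domain S \<Longrightarrow> g \<in> Hplus S \<Longrightarrow> cinner (ast f) g = cinner f (ast g)"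
  using adj_opD[OF ast_in] ast_on_S by fastforce

lemma plus_norm_power2: "(plus_norm S f)\<^sup>2 = (norm f)\<^sup>2 + (norm (ast f))\<^sup>2"
  by (simp add: plus_norm_def plus_inner_def cinner_self)

lemma plus_norm_nonneg: "0 \<le> plus_norm S f"
  by (simp add: plus_norm_def plus_inner_def cinner_self)

lemma norm_le_plus_norm: "norm f \<le> plus_norm S f"
  and norm_ast_le_plus_norm: "norm (ast f) \<le> plus_norm S f"
  using plus_norm_power2[of f] plus_norm_nonneg[of f] by (auto intro: power2_le_imp_le)

lemma cmod_cinner_ast_le: "cmod (cinner (ast f) h) \<le> plus_norm S f * plus_norm S h"
  using norm_cinner_le[of "ast f" h]
  by (meson mult_mono norm_ast_le_plus_norm norm_ge_zero norm_le_plus_norm order_trans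
      plus_norm_nonneg)

lemma vanish_on_dense:
  assumes "\<And>h. h \<in> Domain S \<Longrightarrow> cinner f h = cinner g h"
  shows "f = g"
  using orthogonal_dense_zero[OF dense, of "f - g"] assms by (simp add: cinner_simps)

end

section \<open>Boundary triples and the operators attached to them\<close>

locale boundary_triple = symmetric_operator S
  for S :: "('h::complex_hilbert_space \<times> 'h) set" +
  fixes \<Gamma>0 \<Gamma>1 :: "'h \<Rightarrow> complex"
  assumes closed_S: "closed S"
    and deficiency: "deficiency_indices_1_1 S"
    and \<Gamma>0_add: "f \<in> Hplus S \<Longrightarrow> g \<in> Hplus S \<Longrightarrow> \<Gamma>0 (f + g) = \<Gamma>0 f + \<Gamma>0 g"
    and \<Gamma>0_scale: "f \<in> Hplus S \<Longrightarrow> \<Gamma>0 (c *\<^sub>C f) = c * \<Gamma>0 f"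
    and \<Gamma>1_add: "f \<in> Hplus S \<Longrightarrow> g \<in> Hplus S \<Longrightarrow> \<Gamma>1 (f + g) = \<Gamma>1 f + \<Gamma>1 g"
    and \<Gamma>1_scale: "f \<in> Hplus S \<Longrightarrow> \<Gamma>1 (c *\<^sub>C f) = c * \<Gamma>1 f"
    and \<Gamma>0_bounded: "\<exists>C. \<forall>f\<in>Hplus S. cmod (\<Gamma>0 f) \<le> C * plus_norm S f"
    and \<Gamma>1_bounded: "\<exists>C. \<forall>f\<in>Hplus S. cmod (\<Gamma>1 f) \<le> C * plus_norm S f"
    and green: "f \<in> Hplus S \<Longrightarrow> g \<in> Hplus S \<Longrightarrow>
      cinner (ast f) g - cinner f (ast g) = \<Gamma>1 f * cnj (\<Gamma>0 g) - \<Gamma>0 f * cnj (\<Gamma>1 g)"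
    and self_adjoint_ker: "self_adjoint {(f, f') \<in> adj_op S. \<Gamma>0 f = 0}"
begin

definition A0 :: "('h \<times> 'h) set" where
  "A0 = {(f, f') \<in> adj_op S. \<Gamma>0 f = 0}"

definition main :: "('h \<times> 'h) set" where
  "main = {(f, f') \<in> adj_op S. \<Gamma>0 f + \<i> * \<Gamma>1 f = 0}"

text \<open>The operator \<open>S\<^sup>*\<close> plus a rank-one term along \<open>K 1\<close>. The
  coefficient of that term vanishes on the domain of \<open>main\<close>; its part
  \<open>\<Gamma>0 f\<close> goes into the real part, and \<open>\<Gamma>1 f\<close> produces the
  imaginary part \<open>K K\<^sup>*\<close>.\<close>

definition state :: "'h \<Rightarrow> 'h \<Rightarrow> complex" where
  "state f = (\<lambda>h. if h \<in> Hplus S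
     then cinner (ast f) h + (\<Gamma>0 f + \<i> * \<Gamma>1 f) * cnj (\<Gamma>1 h) else 0)"

definition channel :: "complex \<Rightarrow> 'h \<Rightarrow> complex" where
  "channel c = (\<lambda>h. if h \<in> Hplus S then c * cnj (\<Gamma>1 h) else 0)"

definition system :: "'h l_system" where
  "system = \<lparr>sym_op = S, main_op = main, state_op = state, channel_op = channel\<rparr>"

text \<open>Records just the data that determine the quasi-kernel and the impedance function, so
  that the given system and the constructed one are handled by the same lemmas.\<close>

definition realized_by :: "'h l_system \<Rightarrow> bool" where
  "realized_by \<Theta> \<longleftrightarrow>
     sym_op \<Theta> = S \<and> channel_op \<Theta> 1 = channel 1 \<and>
     (\<forall>f\<in>Hplus S. Re_pm S (state_op \<Theta>) f =
        (\<lambda>h. if h \<in> Hplus S then cinner (ast f) h + \<Gamma>0 f * cnj (\<Gamma>1 h) else 0))"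

lemma A0_iff: "(f, f') \<in> A0 \<longleftrightarrow> f \<in> Hplus S \<and> ast f = f' \<and> \<Gamma>0 f = 0"
  by (auto simp: A0_def in_adj_iff)

lemma main_iff: "(f, f') \<in> main \<longleftrightarrow> f \<in> Hplus S \<and> ast f = f' \<and> \<Gamma>0 f + \<i> * \<Gamma>1 f = 0"
  by (auto simp: main_def in_adj_iff)

lemma self_adjoint_A0: "self_adjoint A0"
  using self_adjoint_ker by (simp add: A0_def)

section \<open>Deficiency vectors and their boundary values\<close>

lemma \<Gamma>0_diff: "f \<in> Hplus S \<Longrightarrow> g \<in> Hplus S \<Longrightarrow> \<Gamma>0 (f - g) = \<Gamma>0 f - \<Gamma>0 g"
  using \<Gamma>0_add[of f "(- 1) *\<^sub>C g"] \<Gamma>0_scale[of g "- 1"] Hplus_scale[of g "- 1"] by simp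

lemma \<Gamma>1_diff: "f \<in> Hplus S \<Longrightarrow> g \<in> Hplus S \<Longrightarrow> \<Gamma>1 (f - g) = \<Gamma>1 f - \<Gamma>1 g"
  using \<Gamma>1_add[of f "(- 1) *\<^sub>C g"] \<Gamma>1_scale[of g "- 1"] Hplus_scale[of g "- 1"] by simp

text \<open>Green's identity with equal arguments. When \<open>\<Gamma>0 f = 1\<close> it reads
  \<open>Im (\<Gamma>1 f) = Im z * (norm f)\<^sup>2\<close>, the positivity of a Weyl
  function.\<close>

lemma green_self:
  assumes "f \<in> ker_shift (adj_op S) z"
  shows "complex_of_real (2 * Im z * (norm f)\<^sup>2) * \<i> = \<Gamma>1 f * cnj (\<Gamma>0 f) - \<Gamma>0 f * cnj (\<Gamma>1 f)"
proof -
  have "(z - cnj z) * cinner f f = \<Gamma>1 f * cnj (\<Gamma>0 f) - \<Gamma>0 f * cnj (\<Gamma>1 f)"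
    using green[of f f] assms by (simp add: ker_shift_iff cinner_simps algebra_simps)
  then show ?thesis
    by (simp add: complex_diff_cnj cinner_self mult_ac)
qed

lemma \<Gamma>0_injective_on_ker:
  assumes "f \<in> ker_shift (adj_op S) z" "Im z \<noteq> 0" "\<Gamma>0 f = 0"
  shows "f = 0"
proof -
  have "complex_of_real (2 * Im z * (norm f)\<^sup>2) * \<i> = 0"
    using green_self[OF assms(1)] assms(3) by simp
  with assms(2) show ?thesis by simp
qed

text \<open>A nonzero deficiency vector is not in the kernel of \<open>\<Gamma>0\<close>, so a
  spanning one can be rescaled to \<open>\<Gamma>0 e = 1\<close>.\<close>

lemma deficiency_vector:
  assumes "z = \<i> \<or> z = - \<i>"
  obtains e where "e \<in> ker_shift (adj_op S) z" "\<Gamma>0 e = 1"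
    "\<And>f. f \<in> ker_shift (adj_op S) z \<Longrightarrow> \<exists>c. f = c *\<^sub>C e"
proof -
  have "cvec.dim (ker_shift (adj_op S) z) = 1"
    using deficiency assms by (auto simp: deficiency_indices_1_1_def)
  then obtain v where v: "v \<in> ker_shift (adj_op S) z" "v \<noteq> 0"
    and mult: "\<And>f. f \<in> ker_shift (adj_op S) z \<Longrightarrow> \<exists>c. f = c *\<^sub>C v"
    using cdim_one_multiple by metis
  have nz: "\<Gamma>0 v \<noteq> 0"
    using \<Gamma>0_injective_on_ker[OF v(1)] v(2) assms by auto
  show thesis
  proof
    show "(1 / \<Gamma>0 v) *\<^sub>C v \<in> ker_shift (adj_op S) z"
      using v(1) by (simp add: ker_shift_iff Hplus_scale ast_scale scaleC_scaleC mult.commute)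
    show "\<Gamma>0 ((1 / \<Gamma>0 v) *\<^sub>C v) = 1"
      using v(1) nz by (simp add: ker_shift_iff \<Gamma>0_scale)
    fix f assume "f \<in> ker_shift (adj_op S) z"
    then obtain c where "f = c *\<^sub>C v" using mult by blast
    then have "f = (c * \<Gamma>0 v) *\<^sub>C (1 / \<Gamma>0 v) *\<^sub>C v"
      using nz by (simp add: scaleC_scaleC)
    then show "\<exists>c. f = c *\<^sub>C (1 / \<Gamma>0 v) *\<^sub>C v" by blast
  qed
qed

text \<open>The normalized deficiency vectors at \<open>\<i>\<close> and \<open>- \<i>\<close> have
  conjugate, nonreal values of \<open>\<Gamma>1\<close>, so their boundary values form a basis of
  the plane.\<close>

lemma boundary_values_surj:
  obtains f where "f \<in> Hplus S" "\<Gamma>0 f = \<alpha>" "\<Gamma>1 f = \<beta>"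
proof -
  obtain e where e: "e \<in> ker_shift (adj_op S) \<i>" "\<Gamma>0 e = 1"
    by (rule deficiency_vector[of \<i>]) auto
  obtain d where d: "d \<in> ker_shift (adj_op S) (- \<i>)" "\<Gamma>0 d = 1"
    by (rule deficiency_vector[of "- \<i>"]) auto
  have H: "e \<in> Hplus S" "d \<in> Hplus S"
    using e d by (simp_all add: ker_shift_iff)
  have "e \<noteq> 0" using e(2) \<Gamma>0_scale[OF H(1), of 0] by auto
  have "Im (\<Gamma>1 e) = (norm e)\<^sup>2"
    using arg_cong[OF green_self[OF e(1)], of Im] by (simp add: e(2))
  moreover have "\<Gamma>1 d = cnj (\<Gamma>1 e)"
  proof -
    have "\<Gamma>1 e - cnj (\<Gamma>1 d) = 0"
      using green[OF H] e d by (simp add: ker_shift_iff cinner_simps)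
    then show ?thesis by (metis complex_cnj_cnj eq_iff_diff_eq_0)
  qed
  ultimately have ne: "\<Gamma>1 e - \<Gamma>1 d \<noteq> 0"
    using \<open>e \<noteq> 0\<close> by (auto simp: complex_eq_iff)
  define c where "c = (\<beta> - \<alpha> * \<Gamma>1 d) / (\<Gamma>1 e - \<Gamma>1 d)"
  have c: "c * (\<Gamma>1 e - \<Gamma>1 d) = \<beta> - \<alpha> * \<Gamma>1 d"
    using ne by (simp add: c_def)
  show thesis
  proof
    show "c *\<^sub>C e + (\<alpha> - c) *\<^sub>C d \<in> Hplus S"
      by (intro Hplus_add Hplus_scale H)
    show "\<Gamma>0 (c *\<^sub>C e + (\<alpha> - c) *\<^sub>C d) = \<alpha>"
      by (simp add: \<Gamma>0_add \<Gamma>0_scale Hplus_scale H e d)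
    show "\<Gamma>1 (c *\<^sub>C e + (\<alpha> - c) *\<^sub>C d) = \<beta>"
      using c by (simp add: \<Gamma>1_add \<Gamma>1_scale Hplus_scale H) (simp add: algebra_simps)
  qed
qed

text \<open>Testing Green's identity on the boundary values \<open>(0, 1)\<close> and
  \<open>(1, 0)\<close> kills both functionals on \<open>S\<close>. Conversely, a common zero
  belongs to the second adjoint, which is \<open>S\<close> by closedness.\<close>

lemma in_S_iff: "(f, f') \<in> S \<longleftrightarrow> f \<in> Hplus S \<and> ast f = f' \<and> \<Gamma>0 f = 0 \<and> \<Gamma>1 f = 0"
proof
  assume S: "(f, f') \<in> S"
  then have f: "f \<in> Hplus S" "f \<in> Domain S" "ast f = f'"
    using Domain_sub_Hplus ast_on_S by auto
  have zero: "\<Gamma>1 f * cnj (\<Gamma>0 g) - \<Gamma>0 f * cnj (\<Gamma>1 g) = 0" if "g \<in> Hplus S" for g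
    using green[OF f(1) that] ast_S_cinner[OF f(2) that] by simp
  obtain g where "g \<in> Hplus S" "\<Gamma>0 g = 0" "\<Gamma>1 g = 1" by (rule boundary_values_surj)
  then have "\<Gamma>0 f = 0" using zero[of g] by simp
  obtain h where "h \<in> Hplus S" "\<Gamma>0 h = 1" "\<Gamma>1 h = 0" by (rule boundary_values_surj)
  then have "\<Gamma>1 f = 0" using zero[of h] by simp
  with f \<open>\<Gamma>0 f = 0\<close> show "f \<in> Hplus S \<and> ast f = f' \<and> \<Gamma>0 f = 0 \<and> \<Gamma>1 f = 0" by simp
next
  assume f: "f \<in> Hplus S \<and> ast f = f' \<and> \<Gamma>0 f = 0 \<and> \<Gamma>1 f = 0"
  have "cinner g' f = cinner g f'" if "(g, g') \<in> adj_op S" for g g'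
    using green[of g f] f that by (simp add: in_adj_iff)
  then show "(f, f') \<in> S"
    by (rule biadjoint_closed[OF lin closed_S])
qed

section \<open>The main operator: adjoint, resolvent set, admissibility\<close>

lemma adj_main_iff: "(f, f') \<in> adj_op main \<longleftrightarrow> f \<in> Hplus S \<and> ast f = f' \<and> \<Gamma>0 f = \<i> * \<Gamma>1 f"
proof
  assume *: "(f, f') \<in> adj_op main"
  have "S \<subseteq> main"
    by (auto simp: in_S_iff main_iff)
  then have f: "f \<in> Hplus S" "ast f = f'"
    using * adj_op_antimono in_adj_iff by blast+
  \<comment> \<open>One element of \<open>main\<close> with nonzero boundary values is enough to
    extract the conjugate of the adjoint boundary condition.\<close>
  obtain g where g: "g \<in> Hplus S" "\<Gamma>0 g = - \<i>" "\<Gamma>1 g = 1" by (rule boundary_values_surj)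
  then have "cinner (ast g) f = cinner g f'"
    using adj_opD[OF *, of g "ast g"] by (simp add: main_iff)
  then have "cnj (\<Gamma>0 f) + \<i> * cnj (\<Gamma>1 f) = 0"
    using green[OF g(1) f(1)] f g by simp
  from arg_cong[OF this, of cnj] f show "f \<in> Hplus S \<and> ast f = f' \<and> \<Gamma>0 f = \<i> * \<Gamma>1 f" by simp
next
  assume f: "f \<in> Hplus S \<and> ast f = f' \<and> \<Gamma>0 f = \<i> * \<Gamma>1 f"
  show "(f, f') \<in> adj_op main"
    unfolding adj_op_in_def
  proof clarsimp
    fix g g' assume g: "(g, g') \<in> main"
    then have "\<Gamma>0 g = - (\<i> * \<Gamma>1 g)" by (simp add: main_iff eq_neg_iff_add_eq_0)
    then show "cinner g' f = cinner g f'"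
      using green[of g f] f g by (simp add: main_iff)
  qed
qed

text \<open>Green's identity gives \<open>Im (cinner f' f) = (cmod (\<Gamma>1 f))\<^sup>2\<close> on
  \<open>main\<close>, hence the estimate at the point \<open>- \<i>\<close> of the lower
  half-plane. For surjectivity, a solution for \<open>A0\<close> is corrected by a deficiency vector
  at the same point.\<close>

lemma resolvent_main: "- \<i> \<in> resolvent_set main"
  unfolding resolvent_set_def
proof (intro CollectI conjI allI exI)
  fix h :: 'h
  obtain u u' where u: "(u, u') \<in> A0" "u' - (- \<i>) *\<^sub>C u = h"
    by (rule self_adjoint_range[OF self_adjoint_A0, of "- \<i>"]) auto
  obtain d where d: "d \<in> ker_shift (adj_op S) (- \<i>)" "\<Gamma>0 d = 1"
    by (rule deficiency_vector[of "- \<i>"]) auto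
  have H: "u \<in> Hplus S" "d \<in> Hplus S"
    using u d by (simp_all add: ker_shift_iff A0_iff)
  have "Im (\<Gamma>1 d) = - (norm d)\<^sup>2"
    using arg_cong[OF green_self[OF d(1)], of Im] by (simp add: d(2))
  then have "Re (1 + \<i> * \<Gamma>1 d) > 0" by (simp add: add_pos_nonneg)
  then have ne: "1 + \<i> * \<Gamma>1 d \<noteq> 0" by (metis less_irrefl zero_complex.simps(1))
  \<comment> \<open>With \<open>\<Gamma>0 u = 0\<close> and \<open>\<Gamma>0 d = 1\<close>, this is
    the coefficient for which \<open>u + c *\<^sub>C d\<close> meets the boundary condition of
    \<open>main\<close>.\<close>
  define c where "c = - (\<i> * \<Gamma>1 u) / (1 + \<i> * \<Gamma>1 d)"
  have c: "c * (1 + \<i> * \<Gamma>1 d) + \<i> * \<Gamma>1 u = 0"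
    using ne by (simp add: c_def)
  have "(u + c *\<^sub>C d, ast (u + c *\<^sub>C d)) \<in> main"
    using c u by (simp add: main_iff Hplus_add Hplus_scale H \<Gamma>0_add \<Gamma>0_scale \<Gamma>1_add \<Gamma>1_scale d
        A0_iff algebra_simps)
  moreover have "ast (u + c *\<^sub>C d) - (- \<i>) *\<^sub>C (u + c *\<^sub>C d) = h"
    using u d H by (simp add: ast_add ast_scale Hplus_scale A0_iff ker_shift_iff scaleC_add_right
        scaleC_scaleC mult.commute)
  ultimately show "\<exists>(f, f')\<in>main. f' - (- \<i>) *\<^sub>C f = h" by blast
next
  show "\<forall>(f, f')\<in>main. norm f \<le> 1 * norm (f' - (- \<i>) *\<^sub>C f)"
  proof safe
    fix f f' assume f: "(f, f') \<in> main"
    then have "\<Gamma>0 f = - (\<i> * \<Gamma>1 f)" by (simp add: main_iff eq_neg_iff_add_eq_0)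
    then have "cinner f' f - cinner f f' = 2 * \<i> * (\<Gamma>1 f * cnj (\<Gamma>1 f))"
      using green[of f f] f by (simp add: main_iff)
    then have "2 * Im (cinner f' f) = 2 * (cmod (\<Gamma>1 f))\<^sup>2"
      using arg_cong[OF cinner_commute[of f f'], of Im]
      by (simp add: complex_eq_iff complex_norm_square[symmetric])
    then have im: "0 \<le> Im (cinner f' f)" by simp
    have "cinner (f' - (- \<i>) *\<^sub>C f) f = cinner f' f + \<i> * complex_of_real ((norm f)\<^sup>2)"
      by (simp add: cinner_simps cinner_self)
    then have "(norm f)\<^sup>2 \<le> Im (cinner (f' - (- \<i>) *\<^sub>C f) f)"
      using im by simp
    also have "\<dots> \<le> norm (f' - (- \<i>) *\<^sub>C f) * norm f"
      using abs_Im_le_cmod norm_cinner_le by (meson abs_le_D1 order_trans)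
    finally show "norm f \<le> 1 * norm (f' - (- \<i>) *\<^sub>C f)"
      by (cases "norm f = 0") (auto simp: power2_eq_square)
  qed
qed

lemma admissible_main_main: "admissible_main S main"
  unfolding admissible_main_def
proof (intro conjI)
  show "lin_operator main"
    unfolding lin_operator_def
  proof (intro conjI allI impI)
    show "(0, 0) \<in> main"
      using lin_operator_zero[OF lin] by (auto simp: in_S_iff main_iff)
    show "single_valued main"
      by (auto simp: single_valued_def main_iff)
    show "(f + g, f' + g') \<in> main" if "(f, f') \<in> main" "(g, g') \<in> main" for f f' g g'
    proof -
      have "\<Gamma>0 (f + g) + \<i> * \<Gamma>1 (f + g) = (\<Gamma>0 f + \<i> * \<Gamma>1 f) + (\<Gamma>0 g + \<i> * \<Gamma>1 g)"
        using that by (simp add: main_iff \<Gamma>0_add \<Gamma>1_add algebra_simps)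
      then show ?thesis
        using that by (simp add: main_iff Hplus_add ast_add)
    qed
    show "(c *\<^sub>C f, c *\<^sub>C f') \<in> main" if "(f, f') \<in> main" for c f f'
    proof -
      have "f \<in> Hplus S" using that by (simp add: main_iff)
      then have "\<Gamma>0 (c *\<^sub>C f) + \<i> * \<Gamma>1 (c *\<^sub>C f) = c * (\<Gamma>0 f + \<i> * \<Gamma>1 f)"
        by (simp add: \<Gamma>0_scale \<Gamma>1_scale algebra_simps)
      then show ?thesis
        using that by (simp add: main_iff Hplus_scale ast_scale)
    qed
  qed
  show "\<not> symmetric_op main"
  proof
    assume "symmetric_op main"
    \<comment> \<open>These boundary values satisfy the condition of \<open>main\<close> but violate
      that of its adjoint.\<close>
    moreover obtain g where "g \<in> Hplus S" "\<Gamma>0 g = - \<i>" "\<Gamma>1 g = 1" by (rule boundary_values_surj)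
    ultimately have "(g, ast g) \<in> adj_op main" "\<Gamma>0 g = - \<i>" "\<Gamma>1 g = 1"
      by (auto simp: symmetric_op_def main_iff)
    then show False by (simp add: adj_main_iff)
  qed
  show "S \<subseteq> main"
    by (auto simp: in_S_iff main_iff)
  show "main \<subseteq> adj_op S"
    by (auto simp: main_def)
  show "resolvent_set main \<noteq> {}"
    using resolvent_main by blast
  \<comment> \<open>The conditions of \<open>main\<close> and its adjoint differ in the sign of
    \<open>\<i> * \<Gamma>1 f\<close>, so together they force both boundary values to
    vanish.\<close>
  show "Domain S = Domain main \<inter> Domain (adj_op main)"
    by (auto simp: in_S_iff main_iff adj_main_iff Domain_iff)
qed

section \<open>The state-space operator, the channel operator and the system\<close>

lemma channel_Hminus: "channel c \<in> Hminus S"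
proof -
  obtain C where C: "\<And>h. h \<in> Hplus S \<Longrightarrow> cmod (\<Gamma>1 h) \<le> C * plus_norm S h"
    using \<Gamma>1_bounded by blast
  have "cmod (channel c h) \<le> (cmod c * C) * plus_norm S h" if "h \<in> Hplus S" for h
    using mult_left_mono[OF C[OF that] norm_ge_zero[of c]] that
    by (simp add: channel_def norm_mult mult.assoc)
  then have "\<exists>C. \<forall>h\<in>Hplus S. cmod (channel c h) \<le> C * plus_norm S h" by blast
  then show ?thesis
    unfolding Hminus_def
    by (simp add: channel_def \<Gamma>1_add \<Gamma>1_scale Hplus_add Hplus_scale distrib_left mult_ac)
qed

lemma bounded_state: "bounded_plus_minus S state"
proof -
  obtain C0 where C0: "\<And>h. h \<in> Hplus S \<Longrightarrow> cmod (\<Gamma>0 h) \<le> C0 * plus_norm S h"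
    using \<Gamma>0_bounded by blast
  obtain C1 where C1: "\<And>h. h \<in> Hplus S \<Longrightarrow> cmod (\<Gamma>1 h) \<le> C1 * plus_norm S h"
    using \<Gamma>1_bounded by blast
  have bound: "cmod (state f h) \<le> (1 + (C0 + C1) * C1) * plus_norm S f * plus_norm S h"
    if f: "f \<in> Hplus S" and h: "h \<in> Hplus S" for f h
  proof -
    have "cmod (\<Gamma>0 f + \<i> * \<Gamma>1 f) \<le> cmod (\<Gamma>0 f) + cmod (\<Gamma>1 f)"
      using norm_triangle_ineq[of "\<Gamma>0 f" "\<i> * \<Gamma>1 f"] by (simp add: norm_mult)
    also have "\<dots> \<le> (C0 + C1) * plus_norm S f"
      using C0[OF f] C1[OF f] by (simp add: distrib_right)
    finally have "cmod (\<Gamma>0 f + \<i> * \<Gamma>1 f) * cmod (\<Gamma>1 h)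
        \<le> ((C0 + C1) * plus_norm S f) * (C1 * plus_norm S h)"
      using C1[OF h] by (meson mult_mono norm_ge_zero order_trans)
    then have "cmod ((\<Gamma>0 f + \<i> * \<Gamma>1 f) * cnj (\<Gamma>1 h))
        \<le> (C0 + C1) * C1 * plus_norm S f * plus_norm S h"
      by (simp add: norm_mult mult_ac)
    moreover have "cmod (state f h)
        \<le> cmod (cinner (ast f) h) + cmod ((\<Gamma>0 f + \<i> * \<Gamma>1 f) * cnj (\<Gamma>1 h))"
      using h by (simp add: state_def norm_triangle_ineq)
    ultimately show ?thesis
      using cmod_cinner_ast_le[of f h] by (simp add: distrib_right)
  qed
  have "state f \<in> Hminus S" if f: "f \<in> Hplus S" for f
    unfolding Hminus_def
  proof (intro CollectI conjI ballI allI impI exI)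
    show "cmod (state f h) \<le> (1 + (C0 + C1) * C1) * plus_norm S f * plus_norm S h"
      if "h \<in> Hplus S" for h
      by (rule bound[OF f that])
  qed (simp_all add: state_def cinner_simps \<Gamma>1_add \<Gamma>1_scale Hplus_add Hplus_scale algebra_simps)
  moreover have "state (f + g) h = state f h + state g h" if "f \<in> Hplus S" "g \<in> Hplus S" for f g h
    using that by (simp add: state_def ast_add cinner_simps \<Gamma>0_add \<Gamma>1_add) (simp add: algebra_simps)
  moreover have "state (c *\<^sub>C f) h = c * state f h" if "f \<in> Hplus S" for c f h
    using that by (simp add: state_def ast_scale cinner_simps \<Gamma>0_scale \<Gamma>1_scale)
      (simp add: algebra_simps)
  ultimately show ?thesis
    unfolding bounded_plus_minus_def using bound by blast
qed

text \<open>Moving \<open>S\<^sup>*\<close> to the other argument by Green's identity cancels the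
  cross term \<open>\<Gamma>1 f * cnj (\<Gamma>0 h)\<close>; only the sign of
  \<open>\<i> * \<Gamma>1 f\<close> changes.\<close>

lemma adj_pm_state:
  assumes "f \<in> Hplus S"
  shows "adj_pm S state f = (\<lambda>h. if h \<in> Hplus S
    then cinner (ast f) h + (\<Gamma>0 f - \<i> * \<Gamma>1 f) * cnj (\<Gamma>1 h) else 0)"
proof
  fix h
  have "cnj (cinner (ast h) f) = cinner f (ast h)"
    by (metis cinner_commute)
  then show "adj_pm S state f h = (if h \<in> Hplus S
      then cinner (ast f) h + (\<Gamma>0 f - \<i> * \<Gamma>1 f) * cnj (\<Gamma>1 h) else 0)"
    using green[OF assms, of h] assms by (simp add: adj_pm_def state_def algebra_simps)
qed

lemma Re_pm_state:
  assumes "f \<in> Hplus S"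
  shows "Re_pm S state f =
    (\<lambda>h. if h \<in> Hplus S then cinner (ast f) h + \<Gamma>0 f * cnj (\<Gamma>1 h) else 0)"
  by (simp add: fun_eq_iff Re_pm_def adj_pm_state[OF assms] state_def field_simps)

lemma Im_pm_state:
  assumes "f \<in> Hplus S"
  shows "Im_pm S state f = channel (\<Gamma>1 f)"
  by (simp add: fun_eq_iff Im_pm_def adj_pm_state[OF assms] state_def channel_def field_simps)

lemma realized_by_system: "realized_by system"
  by (simp add: realized_by_def system_def Re_pm_state)

text \<open>Test vectors in \<open>Domain S\<close> do not see the boundary term and give
  \<open>ast f = f'\<close>; a test vector with \<open>\<Gamma>1 h = 1\<close> then gives
  \<open>\<Gamma>0 f = 0\<close>.\<close>

lemma quasi_kernel_realized:
  assumes "realized_by \<Theta>"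
  shows "quasi_kernel \<Theta> = A0"
proof -
  have "(\<lambda>h. if h \<in> Hplus S then cinner (ast f) h + \<Gamma>0 f * cnj (\<Gamma>1 h) else 0) = embed S f'
      \<longleftrightarrow> ast f = f' \<and> \<Gamma>0 f = 0" (is "?L = ?R \<longleftrightarrow> _") for f f'
  proof
    assume "?L = ?R"
    then have *: "cinner (ast f) h + \<Gamma>0 f * cnj (\<Gamma>1 h) = cinner f' h" if "h \<in> Hplus S" for h
      using that by (simp add: fun_eq_iff embed_def split: if_splits)
    have "ast f = f'"
    proof (rule vanish_on_dense)
      show "cinner (ast f) h = cinner f' h" if "h \<in> Domain S" for h
        using that *[of h] by (auto simp: in_S_iff)
    qed
    moreover obtain h where "h \<in> Hplus S" "\<Gamma>0 h = 0" "\<Gamma>1 h = 1" by (rule boundary_values_surj)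
    ultimately show "ast f = f' \<and> \<Gamma>0 f = 0"
      using *[of h] by simp
  qed (auto simp: embed_def)
  moreover have "sym_op \<Theta> = S"
    and "\<And>f. f \<in> Hplus S \<Longrightarrow> Re_pm S (state_op \<Theta>) f =
      (\<lambda>h. if h \<in> Hplus S then cinner (ast f) h + \<Gamma>0 f * cnj (\<Gamma>1 h) else 0)"
    using assms by (simp_all add: realized_by_def)
  ultimately show ?thesis
    by (intro equalityI subrelI)
      (simp_all add: quasi_kernel_def quasi_kernel_pm_def A0_iff cong: conj_cong)
qed

lemma is_l_system_system:
  assumes "prime_op S"
  shows "is_l_system system"
proof -
  have "star_extension S main state"
    unfolding star_extension_def
  proof (intro conjI)
    show "bounded_plus_minus S state" by (rule bounded_state)
    show "S \<subseteq> main" by (auto simp: in_S_iff main_iff)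
    show "S \<subseteq> adj_op main" by (auto simp: in_S_iff adj_main_iff)
    show "\<forall>(f, f')\<in>main. state f = embed S f'"
      by (auto simp: main_iff state_def embed_def fun_eq_iff)
    show "\<forall>(f, f')\<in>adj_op main. adj_pm S state f = embed S f'"
      by (auto simp: adj_main_iff adj_pm_state embed_def fun_eq_iff)
    show "self_adjoint (quasi_kernel_pm S (Re_pm S state))"
      using quasi_kernel_realized[OF realized_by_system] self_adjoint_A0
      by (simp add: quasi_kernel_def system_def)
  qed
  moreover have "linear_C_minus S channel"
    using channel_Hminus by (auto simp: linear_C_minus_def channel_def algebra_simps)
  moreover have "Im_pm S state f = channel (adj_K channel f)" if "f \<in> Hplus S" for f
    using that by (simp add: Im_pm_state adj_K_def channel_def)
  moreover have "range channel = Im_pm S state ` Hplus S"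
  proof -
    have "channel c \<in> Im_pm S state ` Hplus S" for c
    proof -
      obtain f where "f \<in> Hplus S" "\<Gamma>1 f = c" by (rule boundary_values_surj)
      then show ?thesis using Im_pm_state[of f] by (metis image_eqI)
    qed
    then show ?thesis by (auto simp: Im_pm_state)
  qed
  ultimately show ?thesis
    using assms symmetric closed_S deficiency admissible_main_main
    by (simp add: is_l_system_def system_def admissible_symmetric_def)
qed

section \<open>The impedance function as a Weyl function\<close>

lemma impedance_eqI:
  assumes real: "realized_by \<Theta>"
    and f: "f \<in> ker_shift (adj_op S) z" "\<Gamma>0 f = 1"
    and inj: "\<And>u. (u, z *\<^sub>C u) \<in> A0 \<Longrightarrow> u = 0"
  shows "impedance \<Theta> z = \<Gamma>1 f"
proof -
  define F where "F = (\<lambda>f h. Re_pm S (state_op \<Theta>) f h - z * embed S f h)"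
  have F: "F g = (\<lambda>h. if h \<in> Hplus S
      then cinner (ast g - z *\<^sub>C g) h + \<Gamma>0 g * cnj (\<Gamma>1 h) else 0)" if "g \<in> Hplus S" for g
    using real that by (simp add: F_def realized_by_def embed_def fun_eq_iff cinner_simps)
  have H: "f \<in> Hplus S" and "ast f = z *\<^sub>C f"
    using f by (simp_all add: ker_shift_iff)
  then have "F f = channel 1"
    using f(2) by (simp add: F channel_def fun_eq_iff)
  \<comment> \<open>The function \<open>inv_into\<close> merely picks some preimage. Any preimage
    solves \<open>ast g = z *\<^sub>C g\<close> with \<open>\<Gamma>0 g = 1\<close>, so
    \<open>g - f\<close> lies in the kernel of \<open>A0 - z\<close>, where \<open>inj\<close>
    applies.\<close>
  define g where "g = inv_into (Hplus S) F (channel 1)"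
  have "channel 1 \<in> F ` Hplus S"
    using H \<open>F f = channel 1\<close> by (metis image_eqI)
  then have g: "g \<in> Hplus S" "F g = channel 1"
    unfolding g_def by (rule inv_into_into, rule f_inv_into_f)
  then have *: "cinner (ast g - z *\<^sub>C g) h + \<Gamma>0 g * cnj (\<Gamma>1 h) = cnj (\<Gamma>1 h)" if "h \<in> Hplus S" for h
    using fun_cong[OF g(2)[unfolded F[OF g(1)]], of h] that by (simp add: channel_def)
  have "ast g - z *\<^sub>C g = 0"
  proof (rule vanish_on_dense)
    show "cinner (ast g - z *\<^sub>C g) h = cinner 0 h" if "h \<in> Domain S" for h
      using that *[of h] by (auto simp: in_S_iff)
  qed
  moreover obtain h where "h \<in> Hplus S" "\<Gamma>0 h = 0" "\<Gamma>1 h = 1" by (rule boundary_values_surj)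
  ultimately have "ast g = z *\<^sub>C g" "\<Gamma>0 g = 1"
    using *[of h] by simp_all
  then have "(g - f, z *\<^sub>C (g - f)) \<in> A0"
    using H g f \<open>ast f = z *\<^sub>C f\<close>
    by (simp add: A0_iff Hplus_diff ast_diff \<Gamma>0_diff cvec.scale_right_diff_distrib)
  from inj[OF this] have "g = f" by simp
  then show ?thesis
    using real H by (simp add: impedance_def realized_by_def g_def F_def adj_K_def channel_def)
qed

lemma nonreal_not_eigenvalue: "Im z \<noteq> 0 \<Longrightarrow> (u, z *\<^sub>C u) \<in> A0 \<Longrightarrow> u = 0"
  by (rule \<Gamma>0_injective_on_ker) (auto simp: A0_iff ker_shift_iff)

lemma resolvent_set_not_eigenvalue:
  assumes "z \<in> resolvent_set A0" "(u, z *\<^sub>C u) \<in> A0"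
  shows "u = 0"
proof -
  obtain C where "\<forall>(f, f')\<in>A0. norm f \<le> C * norm (f' - z *\<^sub>C f)"
    using assms(1) by (auto simp: resolvent_set_def)
  from bspec[OF this assms(2)] show ?thesis by simp
qed

text \<open>From any \<open>g\<close> with \<open>\<Gamma>0 g = 1\<close> subtract the solution in
  \<open>A0\<close> of the same inhomogeneous equation. This also covers the real points of the
  resolvent set.\<close>

lemma resolvent_set_vector:
  assumes "z \<in> resolvent_set A0"
  obtains f where "f \<in> ker_shift (adj_op S) z" "\<Gamma>0 f = 1"
proof -
  obtain g where g: "g \<in> Hplus S" "\<Gamma>0 g = 1" by (rule boundary_values_surj)
  obtain u u' where u: "(u, u') \<in> A0" "u' - z *\<^sub>C u = ast g - z *\<^sub>C g"
    using assms by (force simp: resolvent_set_def)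
  show thesis
  proof
    show "g - u \<in> ker_shift (adj_op S) z"
      using g u by (simp add: ker_shift_iff A0_iff Hplus_diff ast_diff
          cvec.scale_right_diff_distrib algebra_simps)
    show "\<Gamma>0 (g - u) = 1"
      using g u by (simp add: A0_iff \<Gamma>0_diff)
  qed
qed

text \<open>As \<open>q\<close> is real, the two new terms
  \<open>q * \<Gamma>0 f * cnj (\<Gamma>0 g)\<close> cancel in Green's identity; the self-adjoint
  restriction depends on \<open>\<Gamma>0\<close> alone and is unchanged.\<close>

lemma shifted_triple: "boundary_triple S \<Gamma>0 (\<lambda>f. \<Gamma>1 f + complex_of_real q * \<Gamma>0 f)"
proof unfold_locales
  obtain C0 where C0: "\<And>h. h \<in> Hplus S \<Longrightarrow> cmod (\<Gamma>0 h) \<le> C0 * plus_norm S h"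
    using \<Gamma>0_bounded by blast
  obtain C1 where C1: "\<And>h. h \<in> Hplus S \<Longrightarrow> cmod (\<Gamma>1 h) \<le> C1 * plus_norm S h"
    using \<Gamma>1_bounded by blast
  have "cmod (\<Gamma>1 f + complex_of_real q * \<Gamma>0 f) \<le> (C1 + \<bar>q\<bar> * C0) * plus_norm S f"
    if "f \<in> Hplus S" for f
    using norm_triangle_ineq[of "\<Gamma>1 f" "complex_of_real q * \<Gamma>0 f"] C1[OF that]
      mult_left_mono[OF C0[OF that] abs_ge_zero[of q]]
    by (simp add: norm_mult distrib_right mult.assoc)
  then show "\<exists>C. \<forall>f\<in>Hplus S. cmod (\<Gamma>1 f + complex_of_real q * \<Gamma>0 f) \<le> C * plus_norm S f"
    by blast
qed (use closed_S deficiency \<Gamma>0_bounded self_adjoint_ker green in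
    \<open>simp_all add: \<Gamma>0_add \<Gamma>0_scale \<Gamma>1_add \<Gamma>1_scale distrib_left distrib_right mult_ac\<close>)

end

section \<open>The boundary triple of an L-system\<close>

lemma self_adjoint_extends:
  assumes "self_adjoint A" "S \<subseteq> A"
  shows "A \<subseteq> adj_op S"
  using adj_op_antimono[OF assms(2)] assms(1) by (simp add: self_adjoint_in_def)

text \<open>
  The form \<open>R f h = (Re \<A> f, h) - (S\<^sup>* f, h)\<close> vanishes for \<open>f\<close> in the domain of the quasi-kernel, which
  has codimension one in \<open>\<H>\<^sub>+\<close>, and equals \<open>-\<i> (Im \<A> f, h)\<close> for \<open>f\<close> in the domain of the main
  operator. Hence it has rank one and factors as \<open>\<Gamma>0 f * cnj (\<Gamma>1 h)\<close> with \<open>\<Gamma>1 = K\<^sup>*\<close>.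
\<close>

lemma l_system_boundary_triple:
  fixes \<Theta> :: "'h::complex_hilbert_space l_system"
  assumes sys: "is_l_system \<Theta>"
  defines "S \<equiv> sym_op \<Theta>" and "\<Gamma>1 \<equiv> adj_K (channel_op \<Theta>)"
  obtains \<Gamma>0 where "boundary_triple S \<Gamma>0 \<Gamma>1" "boundary_triple.realized_by S \<Gamma>0 \<Gamma>1 \<Theta>"
proof -
  define T where "T = main_op \<Theta>"
  define \<A> where "\<A> = state_op \<Theta>"
  define K where "K = channel_op \<Theta>"
  define B where "B = Re_pm S \<A>"
  define \<A>hat where "\<A>hat = quasi_kernel_pm S B"
  have S: "symmetric_op S" "closed S" "deficiency_indices_1_1 S"
    using sys by (simp_all add: is_l_system_def admissible_symmetric_def S_def)
  interpret symmetric_operator S by unfold_locales (rule S)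
  have linT: "lin_operator T" and nsym: "\<not> symmetric_op T" and ST: "S \<subseteq> T" and TS: "T \<subseteq> adj_op S"
    using sys by (simp_all add: is_l_system_def admissible_main_def S_def T_def)
  have bA: "bounded_plus_minus S \<A>" and AT: "\<And>f f'. (f, f') \<in> T \<Longrightarrow> \<A> f = embed S f'"
    and ST': "S \<subseteq> adj_op T" and AT': "\<And>f f'. (f, f') \<in> adj_op T \<Longrightarrow> adj_pm S \<A> f = embed S f'"
    and saA: "self_adjoint \<A>hat"
    using sys by (auto simp: is_l_system_def star_extension_def S_def T_def \<A>_def B_def \<A>hat_def)
  have K: "linear_C_minus S K" and Im: "\<And>f. f \<in> Hplus S \<Longrightarrow> Im_pm S \<A> f = K (\<Gamma>1 f)"
    using sys by (auto simp: is_l_system_def S_def K_def \<A>_def \<Gamma>1_def)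
  have \<Gamma>1_eq: "\<Gamma>1 f = cnj (K 1 f)" for f
    by (simp add: \<Gamma>1_def adj_K_def K_def)
  have K1: "K 1 \<in> Hminus S" and Kc: "K c h = c * cnj (\<Gamma>1 h)" for c h
  proof -
    show "K 1 \<in> Hminus S" using K by (simp add: linear_C_minus_def)
    have "K (c * 1) h = c * K 1 h" using K by (simp only: linear_C_minus_def)
    then show "K c h = c * cnj (\<Gamma>1 h)" by (simp add: \<Gamma>1_eq)
  qed
  have \<Gamma>1_add: "\<Gamma>1 (f + g) = \<Gamma>1 f + \<Gamma>1 g" if "f \<in> Hplus S" "g \<in> Hplus S" for f g
    using K1 that by (simp add: Hminus_def \<Gamma>1_eq)
  have \<Gamma>1_scale: "\<Gamma>1 (c *\<^sub>C f) = c * \<Gamma>1 f" if "f \<in> Hplus S" for c f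
    using K1 that by (simp add: Hminus_def \<Gamma>1_eq)
  have \<Gamma>1_bounded: "\<exists>C. \<forall>f\<in>Hplus S. cmod (\<Gamma>1 f) \<le> C * plus_norm S f"
    using K1 by (simp add: Hminus_def \<Gamma>1_eq)
  have A_add: "\<A> (f + g) h = \<A> f h + \<A> g h" if "f \<in> Hplus S" "g \<in> Hplus S" for f g h
    using bA that by (simp add: bounded_plus_minus_def)
  have A_scale: "\<A> (c *\<^sub>C f) h = c * \<A> f h" if "f \<in> Hplus S" for c f h
    using bA that by (simp add: bounded_plus_minus_def)
  have A_minus: "\<A> f \<in> Hminus S" if "f \<in> Hplus S" for f
    using bA that by (simp add: bounded_plus_minus_def)
  have A_add': "\<A> h (f + g) = \<A> h f + \<A> h g"
    if "f \<in> Hplus S" "g \<in> Hplus S" "h \<in> Hplus S" for f g h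
    using A_minus[OF that(3)] that by (simp add: Hminus_def)
  have A_scale': "\<A> h (c *\<^sub>C f) = cnj c * \<A> h f" if "f \<in> Hplus S" "h \<in> Hplus S" for c f h
    using A_minus[OF that(2)] that by (simp add: Hminus_def)
  have B_eq: "B f h = (\<A> f h + cnj (\<A> h f)) / 2" if "h \<in> Hplus S" for f h
    using that by (simp add: B_def Re_pm_def adj_pm_def)
  have B_off: "B f h = 0" if "f \<in> Hplus S" "h \<notin> Hplus S" for f h
    using A_minus[OF that(1)] that(2) by (simp add: B_def Re_pm_def adj_pm_def Hminus_def)
  have B_herm: "B f h = cnj (B h f)" if "f \<in> Hplus S" "h \<in> Hplus S" for f h
    using that by (simp add: B_eq add.commute)
  have B_add: "B (f + g) h = B f h + B g h"
    if "f \<in> Hplus S" "g \<in> Hplus S" "h \<in> Hplus S" for f g h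
    using that by (simp add: B_eq A_add A_add' field_simps)
  have B_scale: "B (c *\<^sub>C f) h = c * B f h" if "f \<in> Hplus S" "h \<in> Hplus S" for c f h
    using that by (simp add: B_eq A_scale A_scale' field_simps)
  \<comment> \<open>Sum and difference of \<open>\<A>\<close> and its adjoint are
    \<open>2 * B\<close> and, by the channel identity, \<open>2 * \<i>\<close> times a rank-one
    form.\<close>
  have A_eq: "\<A> f h = B f h + \<i> * \<Gamma>1 f * cnj (\<Gamma>1 h)"
    and A_eq': "adj_pm S \<A> f h = B f h - \<i> * \<Gamma>1 f * cnj (\<Gamma>1 h)"
    if "f \<in> Hplus S" "h \<in> Hplus S" for f h
  proof -
    have "\<A> f h - adj_pm S \<A> f h = 2 * \<i> * (\<Gamma>1 f * cnj (\<Gamma>1 h))"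
      using fun_cong[OF Im[OF that(1)], of h] by (simp add: Im_pm_def Kc field_simps)
    moreover have "\<A> f h + adj_pm S \<A> f h = 2 * B f h"
      by (simp add: B_def Re_pm_def)
    ultimately have "2 * \<A> f h = 2 * (B f h + \<i> * \<Gamma>1 f * cnj (\<Gamma>1 h))"
      and "2 * adj_pm S \<A> f h = 2 * (B f h - \<i> * \<Gamma>1 f * cnj (\<Gamma>1 h))"
      by algebra+
    then show "\<A> f h = B f h + \<i> * \<Gamma>1 f * cnj (\<Gamma>1 h)"
      and "adj_pm S \<A> f h = B f h - \<i> * \<Gamma>1 f * cnj (\<Gamma>1 h)"
      by (simp_all only: mult_cancel_left) simp_all
  qed
  have S_sub: "S \<subseteq> \<A>hat"
  proof clarify
    fix f f' assume f: "(f, f') \<in> S"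
    then have "\<A> f = embed S f'" "adj_pm S \<A> f = embed S f'"
      using ST ST' AT AT' by blast+
    then have "B f = embed S f'"
      by (simp add: B_def Re_pm_def fun_eq_iff)
    then show "(f, f') \<in> \<A>hat"
      using f Domain_sub_Hplus by (auto simp: \<A>hat_def quasi_kernel_pm_def)
  qed
  then have hat_adj: "\<A>hat \<subseteq> adj_op S"
    by (rule self_adjoint_extends[OF saA])
  have hat_iff: "(f, f') \<in> \<A>hat \<longleftrightarrow> f \<in> Hplus S \<and> ast f = f' \<and> (\<forall>h\<in>Hplus S. B f h = cinner (ast f) h)"
    for f f'
  proof -
    have "(f, f') \<in> \<A>hat \<longleftrightarrow> f \<in> Hplus S \<and> (\<forall>h\<in>Hplus S. B f h = cinner f' h)"
      using B_off[of f] by (auto simp: \<A>hat_def quasi_kernel_pm_def fun_eq_iff embed_def)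
    moreover have "(f, f') \<in> \<A>hat \<Longrightarrow> ast f = f'"
      using hat_adj in_adj_iff by blast
    ultimately show ?thesis by auto
  qed
  have B_T: "B f h = cinner (ast f) h - \<i> * \<Gamma>1 f * cnj (\<Gamma>1 h)"
    if f: "f \<in> Domain T" and h: "h \<in> Hplus S" for f h
  proof -
    obtain f' where f': "(f, f') \<in> T" using f by blast
    then have "f \<in> Hplus S" "ast f = f'"
      using TS in_adj_iff by blast+
    then show ?thesis
      using A_eq[of f h] AT[OF f'] h by (simp add: embed_def)
  qed
  \<comment> \<open>Otherwise \<open>T\<close> would be a restriction of a self-adjoint operator and
    therefore symmetric. The vector \<open>t\<close> obtained from this spans \<open>Hplus S\<close>
    modulo the domain of the quasi-kernel.\<close>
  have "\<not> Domain T \<subseteq> Domain \<A>hat"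
  proof
    assume D: "Domain T \<subseteq> Domain \<A>hat"
    have "T \<subseteq> \<A>hat"
    proof clarify
      fix f f' assume f: "(f, f') \<in> T"
      then obtain g where "(f, g) \<in> \<A>hat" using D by blast
      then show "(f, f') \<in> \<A>hat"
        using f TS hat_adj adj_op_unique[OF dense] by blast
    qed
    then have "T \<subseteq> adj_op T"
      using self_adjoint_extends[OF saA] by blast
    moreover have "closure (Domain T) = UNIV"
      using closure_mono[OF Domain_mono[OF ST]] dense by blast
    ultimately show False
      using nsym linT by (simp add: symmetric_op_def)
  qed
  then obtain t where t: "t \<in> Domain T" "t \<notin> Domain \<A>hat" by blast
  then have tH: "t \<in> Hplus S"
    using TS by (auto simp: Hplus_def)
  have \<Gamma>1t: "\<Gamma>1 t \<noteq> 0"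
  proof
    assume "\<Gamma>1 t = 0"
    then have "(t, ast t) \<in> \<A>hat"
      using B_T[OF t(1)] tH by (simp add: hat_iff)
    with t(2) show False by blast
  qed
  \<comment> \<open>Subtracting suitable elements of the quasi-kernel moves \<open>f\<close> and
    \<open>t\<close> into the deficiency subspace at \<open>\<i>\<close>, which is one-dimensional;
    the remainder of \<open>t\<close> is nonzero.\<close>
  have codim: "\<exists>u c. u \<in> Domain \<A>hat \<and> f = u + c *\<^sub>C t" if f: "f \<in> Hplus S" for f
  proof -
    have "\<exists>u. u \<in> Domain \<A>hat \<and> g - u \<in> ker_shift (adj_op S) \<i>" if g: "g \<in> Hplus S" for g
    proof -
      obtain u u' where u: "(u, u') \<in> \<A>hat" "u' - \<i> *\<^sub>C u = ast g - \<i> *\<^sub>C g"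
        by (rule self_adjoint_range[OF saA]) auto
      then have "g - u \<in> ker_shift (adj_op S) \<i>"
        using g by (simp add: ker_shift_iff hat_iff Hplus_diff ast_diff
            cvec.scale_right_diff_distrib algebra_simps)
      with u(1) show ?thesis by blast
    qed
    then obtain u v where u: "u \<in> Domain \<A>hat" "f - u \<in> ker_shift (adj_op S) \<i>"
      and v: "v \<in> Domain \<A>hat" "t - v \<in> ker_shift (adj_op S) \<i>"
      using f tH by metis
    obtain e where e: "\<And>x. x \<in> ker_shift (adj_op S) \<i> \<Longrightarrow> \<exists>c. x = c *\<^sub>C e"
      using cdim_one_multiple S(3) unfolding deficiency_indices_1_1_def by metis
    obtain \<alpha> \<beta> where ab: "f - u = \<alpha> *\<^sub>C e" "t - v = \<beta> *\<^sub>C e"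
      using e u(2) v(2) by metis
    have "\<beta> \<noteq> 0" using ab(2) t(2) v(1) by auto
    have "f = u + (\<alpha> / \<beta>) *\<^sub>C (\<beta> *\<^sub>C e)"
      using ab(1) \<open>\<beta> \<noteq> 0\<close> by (simp add: scaleC_scaleC algebra_simps)
    then have "f = (u - (\<alpha> / \<beta>) *\<^sub>C v) + (\<alpha> / \<beta>) *\<^sub>C t"
      unfolding ab(2)[symmetric] by (simp add: cvec.scale_right_diff_distrib)
    moreover have "u - (\<alpha> / \<beta>) *\<^sub>C v \<in> Domain \<A>hat"
    proof -
      have l: "lin_operator \<A>hat" using saA by (simp add: self_adjoint_in_def)
      show ?thesis
        using lin_operator_diff[OF l _ lin_operator_scale[OF l]] u(1) v(1) by blast
    qed
    ultimately show ?thesis by blast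
  qed
  \<comment> \<open>Since \<open>\<Gamma>1 h0 = 1\<close>, evaluating the rank-one form at
    \<open>h0\<close> returns its coefficient, which is taken as \<open>\<Gamma>0 f\<close>.\<close>
  define h0 where "h0 = (1 / \<Gamma>1 t) *\<^sub>C t"
  have h0: "h0 \<in> Hplus S" "\<Gamma>1 h0 = 1"
    using tH \<Gamma>1t by (simp_all add: h0_def Hplus_scale \<Gamma>1_scale)
  define \<Gamma>0 where "\<Gamma>0 f = B f h0 - cinner (ast f) h0" for f
  have B_\<Gamma>: "B f h = cinner (ast f) h + \<Gamma>0 f * cnj (\<Gamma>1 h)"
    if f: "f \<in> Hplus S" and h: "h \<in> Hplus S" for f h
  proof -
    obtain u c where u: "u \<in> Domain \<A>hat" "f = u + c *\<^sub>C t" using codim[OF f] by blast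
    have R: "B f k - cinner (ast f) k = - c * \<i> * \<Gamma>1 t * cnj (\<Gamma>1 k)" if k: "k \<in> Hplus S" for k
    proof -
      have "u \<in> Hplus S" "B u k = cinner (ast u) k"
        using u(1) k by (auto simp: hat_iff)
      then show ?thesis
        using k tH u(2)
        by (simp add: B_T[OF t(1) k] B_add B_scale Hplus_scale ast_add ast_scale cinner_simps algebra_simps)
    qed
    have "- c * \<i> * \<Gamma>1 t = \<Gamma>0 f"
      using R[OF h0(1)] h0(2) by (simp add: \<Gamma>0_def)
    with R[OF h] show ?thesis
      by (simp only: diff_eq_eq add.commute)
  qed
  have \<A>hat_eq: "\<A>hat = {(f, f') \<in> adj_op S. \<Gamma>0 f = 0}"
  proof -
    have "(\<forall>h\<in>Hplus S. B f h = cinner (ast f) h) \<longleftrightarrow> \<Gamma>0 f = 0" if "f \<in> Hplus S" for f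
      using that B_\<Gamma>[OF that] h0 by auto
    then show ?thesis
      by (auto simp: hat_iff in_adj_iff)
  qed
  have triple: "boundary_triple S \<Gamma>0 \<Gamma>1"
  proof unfold_locales
    fix f g assume fg: "f \<in> Hplus S" "g \<in> Hplus S"
    show "\<Gamma>0 (f + g) = \<Gamma>0 f + \<Gamma>0 g"
      using fg h0 by (simp add: \<Gamma>0_def B_add ast_add cinner_simps)
    \<comment> \<open>Green's identity is the hermitian symmetry of \<open>B\<close> written out
      with the rank-one formula.\<close>
    show "cinner (ast f) g - cinner f (ast g) = \<Gamma>1 f * cnj (\<Gamma>0 g) - \<Gamma>0 f * cnj (\<Gamma>1 g)"
    proof -
      have "cnj (cinner (ast g) f) = cinner f (ast g)"
        by (metis cinner_commute)
      then show ?thesis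
        using B_herm[OF fg] B_\<Gamma>[OF fg] B_\<Gamma>[OF fg(2,1)] by (simp add: algebra_simps)
    qed
  next
    fix f c assume "f \<in> Hplus S"
    then show "\<Gamma>0 (c *\<^sub>C f) = c * \<Gamma>0 f"
      using h0 by (simp add: \<Gamma>0_def B_scale ast_scale cinner_simps algebra_simps)
  next
    obtain C where C: "\<And>f h. f \<in> Hplus S \<Longrightarrow> h \<in> Hplus S \<Longrightarrow>
        cmod (\<A> f h) \<le> C * plus_norm S f * plus_norm S h"
      using bA unfolding bounded_plus_minus_def by blast
    have "cmod (\<Gamma>0 f) \<le> ((C + 1) * plus_norm S h0) * plus_norm S f" if f: "f \<in> Hplus S" for f
    proof -
      have "2 * cmod (B f h0) \<le> cmod (\<A> f h0) + cmod (\<A> h0 f)"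
        using norm_triangle_ineq[of "\<A> f h0" "cnj (\<A> h0 f)"] h0 by (simp add: B_eq norm_divide)
      also have "\<dots> \<le> 2 * (C * plus_norm S f * plus_norm S h0)"
        using C[OF f h0(1)] C[OF h0(1) f] by (simp add: mult_ac)
      finally show ?thesis
        using norm_triangle_ineq4[of "B f h0" "cinner (ast f) h0"] cmod_cinner_ast_le[of f h0]
        by (simp add: \<Gamma>0_def algebra_simps)
    qed
    then show "\<exists>C. \<forall>f\<in>Hplus S. cmod (\<Gamma>0 f) \<le> C * plus_norm S f" by blast
  next
    show "self_adjoint {(f, f') \<in> adj_op S. \<Gamma>0 f = 0}"
      using saA by (simp add: \<A>hat_eq)
  qed (use S \<Gamma>1_add \<Gamma>1_scale \<Gamma>1_bounded in auto)
  interpret boundary_triple S \<Gamma>0 \<Gamma>1 by (rule triple)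
  have "realized_by \<Theta>"
    unfolding realized_by_def
  proof (intro conjI ballI ext)
    show "sym_op \<Theta> = S" by (simp add: S_def)
    show "channel_op \<Theta> 1 h = channel 1 h" for h
      unfolding K_def[symmetric] using K1 by (simp add: channel_def \<Gamma>1_eq Hminus_def)
    show "Re_pm S (state_op \<Theta>) f h =
        (if h \<in> Hplus S then cinner (ast f) h + \<Gamma>0 f * cnj (\<Gamma>1 h) else 0)"
      if "f \<in> Hplus S" for f h
      using that B_\<Gamma>[OF that, of h] B_off[OF that, of h] by (simp add: B_def \<A>_def)
  qed
  with triple show thesis by (rule that)
qed

section \<open>The von Neumann parameters\<close>

lemma class_M_inv_at_ii:
  assumes "M \<in> class_M_inv \<kappa>0" "0 \<le> \<kappa>0" "\<kappa>0 < 1"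
  shows "M \<i> = \<i> * complex_of_real ((1 + \<kappa>0) / (1 - \<kappa>0))"
proof -
  obtain \<mu> :: "real measure" where \<mu>: "sets \<mu> = sets borel"
    "(\<integral>\<^sup>+ t. ennreal (1 / (1 + t\<^sup>2)) \<partial>\<mu>) = ennreal ((1 + \<kappa>0) / (1 - \<kappa>0))"
    "M \<i> = (\<integral>t. 1 / (complex_of_real t - \<i>) - complex_of_real (t / (1 + t\<^sup>2)) \<partial>\<mu>)"
    using assms(1) unfolding class_M_inv_def by force
  \<comment> \<open>At \<open>\<i>\<close> the regularizing term removes exactly the real part of
    the kernel, leaving \<open>\<i>\<close> times the integrand whose integral the class
    prescribes.\<close>
  have eq: "1 / (complex_of_real t - \<i>) - complex_of_real (t / (1 + t\<^sup>2))
      = \<i> * complex_of_real (1 / (1 + t\<^sup>2))" for t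
  proof -
    have "1 + t\<^sup>2 \<noteq> 0"
      using zero_le_power2[of t] by linarith
    then show ?thesis
      by (simp add: complex_eq_iff Re_divide Im_divide add.commute power2_eq_square[of "1 + t\<^sup>2"])
  qed
  have [measurable_cong]: "sets \<mu> = sets borel" by (rule \<mu>(1))
  have "integral\<^sup>L \<mu> (\<lambda>t. 1 / (1 + t\<^sup>2)) = (1 + \<kappa>0) / (1 - \<kappa>0)"
  proof (subst integral_eq_nn_integral)
    show "(\<lambda>t. 1 / (1 + t\<^sup>2)) \<in> borel_measurable \<mu>" by measurable
  qed (use \<mu>(2) assms(2,3) in auto)
  then have "(\<integral>t. complex_of_real (1 / (1 + t\<^sup>2)) \<partial>\<mu>) = complex_of_real ((1 + \<kappa>0) / (1 - \<kappa>0))"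
    by (subst integral_complex_of_real) simp
  then show ?thesis
    unfolding \<mu>(3) eq by (simp only: integral_mult_right_zero)
qed

text \<open>The right-hand side is the modulus of
  \<open>(1 - a + \<i> * q) / (1 + a + \<i> * q)\<close>. With \<open>m\<close> and \<open>p\<close>
  the squared moduli of numerator and denominator, \<open>s\<^sup>2 = m * p\<close>, and the
  left-hand side collapses to \<open>s / p\<close>.\<close>

lemma kappa_closed_form:
  fixes a q :: real
  assumes a: "1 \<le> a" and q: "q \<noteq> 0"
  defines "b \<equiv> q\<^sup>2 + a\<^sup>2 - 1"
  defines "s \<equiv> sqrt (b\<^sup>2 + 4 * q\<^sup>2)"
  shows "(a * (b + s)\<^sup>2 - (b - 2 * q\<^sup>2 + s)\<^sup>2 - 4 * q\<^sup>2 * a * (a - 1)) /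
      ((b - 2 * q\<^sup>2 + s)\<^sup>2 + a * (b + s)\<^sup>2 + 4 * q\<^sup>2 * a * (a + 1))
    = sqrt (((a - 1)\<^sup>2 + q\<^sup>2) / ((a + 1)\<^sup>2 + q\<^sup>2))"
proof -
  define m where "m = (a - 1)\<^sup>2 + q\<^sup>2"
  define p where "p = (a + 1)\<^sup>2 + q\<^sup>2"
  have q2: "0 < q\<^sup>2" using q by simp
  have s2: "s\<^sup>2 = b\<^sup>2 + 4 * q\<^sup>2" by (simp add: s_def)
  have smp: "s\<^sup>2 = m * p"
    unfolding s2 b_def m_def p_def by algebra
  have pos: "0 < m" "0 < p"
    using q2 by (simp_all add: m_def p_def add_nonneg_pos)
  have s0: "0 < s" using q2 by (simp add: s_def add_nonneg_pos)
  have "0 \<le> b"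
    using one_le_power[OF a, of 2] q2 unfolding b_def by linarith
  \<comment> \<open>The cofactors of \<open>2 * m\<close> and \<open>2 * p\<close> in numerator and
    denominator. They equal \<open>(a - 1) * p + (a + 1) * s\<close> and
    \<open>(a - 1) * s + (a + 1) * m\<close>, whence \<open>m * n = s * d\<close>.\<close>
  define n where "n = (a + 1) * (b + s) - 2 * q\<^sup>2"
  define d where "d = (a - 1) * (b + s) + 2 * q\<^sup>2"
  have num: "a * (b + s)\<^sup>2 - (b - 2 * q\<^sup>2 + s)\<^sup>2 - 4 * q\<^sup>2 * a * (a - 1) = 2 * m * n"
    using s2 unfolding m_def n_def b_def by algebra
  have den: "(b - 2 * q\<^sup>2 + s)\<^sup>2 + a * (b + s)\<^sup>2 + 4 * q\<^sup>2 * a * (a + 1) = 2 * p * d"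
    using s2 unfolding p_def d_def b_def by algebra
  have key: "m * n = s * d"
  proof -
    have "m * n = m * ((a - 1) * p + (a + 1) * s)"
      unfolding n_def b_def p_def by algebra
    also have "\<dots> = (a - 1) * s\<^sup>2 + m * (a + 1) * s"
      unfolding smp by algebra
    also have "\<dots> = s * d"
      unfolding d_def b_def m_def by algebra
    finally show ?thesis .
  qed
  have "0 < d"
    using a q2 \<open>0 \<le> b\<close> s0 by (simp add: d_def add_nonneg_pos)
  then have "(2 * m * n) / (2 * p * d) = s / p"
    using key pos by (simp add: field_simps)
  also have "s / p = sqrt (m / p)"
  proof (rule real_sqrt_unique[symmetric])
    show "(s / p)\<^sup>2 = m / p"
      using pos by (simp add: power_divide smp) (simp add: power2_eq_square)
  qed (use s0 pos in simp)
  finally show ?thesis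
    unfolding num den by (simp add: m_def p_def)
qed

text \<open>With \<open>x\<close> and \<open>y\<close> as in the proof, the formula for
  \<open>U\<close> says that \<open>2 * \<kappa> * U\<close> is
  \<open>- cnj x - \<kappa>\<^sup>2 * y\<close>. Multiplying by \<open>x\<close> and using that
  \<open>x * cnj x\<close> is \<open>\<kappa>\<^sup>2 * y * cnj y\<close> and that
  \<open>x + cnj y = 2\<close> gives the first claim; moduli give the second.\<close>

lemma quasi_kernel_parameter:
  fixes a q \<kappa> :: real
  assumes \<kappa>: "0 < \<kappa>" and q: "q \<noteq> 0"
    and mod: "cmod (complex_of_real (1 - a) + \<i> * q) = \<kappa> * cmod (complex_of_real (1 + a) + \<i> * q)"
  defines "U \<equiv> ((complex_of_real a + complex_of_real q * \<i>) * (1 - (complex_of_real \<kappa>)\<^sup>2)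
               - 1 - (complex_of_real \<kappa>)\<^sup>2) / (2 * complex_of_real \<kappa>)"
  shows "U * (complex_of_real (1 - a) + \<i> * q) = - complex_of_real \<kappa> * (complex_of_real (1 + a) + \<i> * q)"
    and "cmod U = 1"
proof -
  define x y where "x = complex_of_real (1 - a) + \<i> * q" and "y = complex_of_real (1 + a) + \<i> * q"
  have sq: "(1 - a)\<^sup>2 + q\<^sup>2 = \<kappa>\<^sup>2 * ((1 + a)\<^sup>2 + q\<^sup>2)"
    using arg_cong[OF mod, of "\<lambda>t. t\<^sup>2"] by (simp add: power_mult_distrib cmod_power2)
  \<comment> \<open>Here \<open>x - 2 + 2 * a\<close> is \<open>- cnj x\<close>, and
    \<open>x - 2\<close> in the next identity is \<open>- cnj y\<close>; this form keeps the final
    step polynomial.\<close>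
  have "(x - 2 + 2 * a) * x = - complex_of_real ((1 - a)\<^sup>2 + q\<^sup>2)"
    by (simp add: x_def complex_eq_iff power2_eq_square algebra_simps)
  moreover have "y * (x - 2) = - complex_of_real ((1 + a)\<^sup>2 + q\<^sup>2)"
    by (simp add: x_def y_def complex_eq_iff power2_eq_square algebra_simps)
  ultimately have "(x - 2 + 2 * a) * x = (complex_of_real \<kappa>)\<^sup>2 * (y * (x - 2))"
    by (simp only: sq of_real_mult of_real_power mult_minus_right)
  moreover have "U * (2 * complex_of_real \<kappa>) = (x - 2 + 2 * a) - (complex_of_real \<kappa>)\<^sup>2 * y"
  proof -
    have "U * (2 * complex_of_real \<kappa>) = (complex_of_real a + complex_of_real q * \<i>)
        * (1 - (complex_of_real \<kappa>)\<^sup>2) - 1 - (complex_of_real \<kappa>)\<^sup>2"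
      using \<kappa> by (simp add: U_def)
    also have "\<dots> = (x - 2 + 2 * a) - (complex_of_real \<kappa>)\<^sup>2 * y"
      by (simp add: x_def y_def algebra_simps)
    finally show ?thesis .
  qed
  ultimately have "(2 * complex_of_real \<kappa>) * (U * x) = (2 * complex_of_real \<kappa>) * (- complex_of_real \<kappa> * y)"
    by algebra
  then have Ux: "U * x = - complex_of_real \<kappa> * y"
    using \<kappa> by (subst (asm) mult_cancel_left) simp
  then show "U * (complex_of_real (1 - a) + \<i> * q) = - complex_of_real \<kappa> * (complex_of_real (1 + a) + \<i> * q)"
    by (simp add: x_def y_def)
  have "cmod U * cmod x = cmod x"
    using arg_cong[OF Ux, of cmod] mod \<kappa> by (simp add: norm_mult x_def y_def)
  moreover have "x \<noteq> 0"
    using q by (simp add: x_def complex_eq_iff)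
  ultimately show "cmod U = 1" by simp
qed

section \<open>Parameters of the main operator and of the quasi-kernel\<close>

context boundary_triple
begin

text \<open>
  The vectors \<open>e\<close> and \<open>d\<close> of the deficiency subspaces with \<open>\<Gamma>0 = 1\<close> both have norm \<open>sqrt a\<close>, so a
  normalized pair differs from them only by phases and a common factor.
\<close>

lemma main_parameters:
  fixes a q \<kappa> :: real
  assumes e: "e \<in> ker_shift (adj_op S) \<i>" "\<Gamma>0 e = 1" "\<Gamma>1 e = q + \<i> * a" and a: "0 < a"
    and q: "q \<noteq> 0"
    and \<kappa>: "0 < \<kappa>" "\<kappa> < 1"
    and mod: "cmod (complex_of_real (1 - a) + \<i> * q) = \<kappa> * cmod (complex_of_real (1 + a) + \<i> * q)"
  defines "U \<equiv> ((complex_of_real a + complex_of_real q * \<i>) * (1 - (complex_of_real \<kappa>)\<^sup>2)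
               - 1 - (complex_of_real \<kappa>)\<^sup>2) / (2 * complex_of_real \<kappa>)"
  shows "\<exists>gp gm. adapted_pair S main gp gm \<kappa>"
    and "adapted_pair S main gp gm \<kappa>' \<Longrightarrow> \<kappa>' = \<kappa> \<and> self_adjoint_parameter A0 gp gm U"
proof -
  define x y where "x = complex_of_real (1 - a) + \<i> * q" and "y = complex_of_real (1 + a) + \<i> * q"
  have xy: "x \<noteq> 0" "y \<noteq> 0"
    using q by (simp_all add: x_def y_def complex_eq_iff)
  obtain d where d: "d \<in> ker_shift (adj_op S) (- \<i>)" "\<Gamma>0 d = 1"
    and d_mult: "\<And>f. f \<in> ker_shift (adj_op S) (- \<i>) \<Longrightarrow> \<exists>c. f = c *\<^sub>C d"
    by (rule deficiency_vector[of "- \<i>"]) auto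
  \<comment> \<open>The normalization \<open>\<Gamma>0 = 1\<close> identifies the given
    \<open>e\<close> with a spanning vector.\<close>
  have e_mult: "\<exists>c. f = c *\<^sub>C e" if "f \<in> ker_shift (adj_op S) \<i>" for f
  proof -
    obtain v where v: "\<Gamma>0 v = 1" "v \<in> ker_shift (adj_op S) \<i>"
      "\<And>f. f \<in> ker_shift (adj_op S) \<i> \<Longrightarrow> \<exists>c. f = c *\<^sub>C v"
      by (rule deficiency_vector[of \<i>]) auto
    obtain c where "e = c *\<^sub>C v" using v(3) e(1) by blast
    then have "e = v"
      using e(2) v(1,2) \<Gamma>0_scale[of v c] by (simp add: ker_shift_iff)
    then show ?thesis using v(3) that by blast
  qed
  have H: "e \<in> Hplus S" "d \<in> Hplus S"
    using e d by (simp_all add: ker_shift_iff)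
  have \<Gamma>1d: "\<Gamma>1 d = q - \<i> * a"
  proof -
    have "\<Gamma>1 e - cnj (\<Gamma>1 d) = 0"
      using green[OF H] e d by (simp add: ker_shift_iff cinner_simps)
    then have "\<Gamma>1 d = cnj (\<Gamma>1 e)" by (metis complex_cnj_cnj eq_iff_diff_eq_0)
    then show ?thesis by (simp add: e(3))
  qed
  have norms: "norm e = sqrt a" "norm d = sqrt a"
    using arg_cong[OF green_self[OF e(1)], of Im] arg_cong[OF green_self[OF d(1)], of Im]
    by (auto simp: e d \<Gamma>1d intro!: real_sqrt_unique[symmetric])
  \<comment> \<open>The numbers \<open>x\<close> and \<open>y\<close> are the values of
    \<open>\<Gamma>0 + \<i> * \<Gamma>1\<close> at \<open>e\<close> and \<open>d\<close>, so the
    boundary condition becomes one linear equation.\<close>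
  have main: "\<alpha> *\<^sub>C e - \<beta> *\<^sub>C d \<in> Domain main \<longleftrightarrow> \<alpha> * x = \<beta> * y" for \<alpha> \<beta>
  proof -
    have "\<Gamma>0 (\<alpha> *\<^sub>C e - \<beta> *\<^sub>C d) + \<i> * \<Gamma>1 (\<alpha> *\<^sub>C e - \<beta> *\<^sub>C d) = \<alpha> * x - \<beta> * y"
      using H by (simp add: \<Gamma>0_diff \<Gamma>1_diff \<Gamma>0_scale \<Gamma>1_scale Hplus_scale e d \<Gamma>1d x_def y_def
          algebra_simps)
    then show ?thesis
      using H by (simp add: Domain_iff main_iff Hplus_diff Hplus_scale)
  qed
  have A0: "\<alpha> *\<^sub>C e + \<beta> *\<^sub>C d \<in> Domain A0 \<longleftrightarrow> \<alpha> + \<beta> = 0" for \<alpha> \<beta>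
    using H by (simp add: Domain_iff A0_iff Hplus_add Hplus_scale \<Gamma>0_add \<Gamma>0_scale e d)
  have Ux: "U * x = - complex_of_real \<kappa> * y" and cU: "cmod U = 1"
    unfolding U_def x_def y_def by (rule quasi_kernel_parameter[OF \<kappa>(1) q mod])+
  have mod': "cmod x = \<kappa> * cmod y"
    using mod by (simp add: x_def y_def)
  \<comment> \<open>This is the phase of the second vector that turns the parameter into the
    positive number \<open>\<kappa>\<close>; it has modulus one by \<open>mod'\<close>.\<close>
  define r where "r = x / (\<kappa> * y)"
  have r: "cmod r = 1" "\<kappa> * r * y = x"
    using xy \<kappa> mod' by (simp_all add: r_def norm_divide norm_mult)
  define g h where "g = (1 / sqrt a) *\<^sub>C e" and "h = (r / sqrt a) *\<^sub>C d"
  have "norm g = 1" "norm h = 1"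
    using a by (simp_all add: g_def h_def norm_scaleC norm_divide norms r(1))
  moreover have "g \<in> ker_shift (adj_op S) \<i>" "h \<in> ker_shift (adj_op S) (- \<i>)"
    using e(1) d(1)
    by (simp_all add: g_def h_def ker_shift_iff Hplus_scale ast_scale scaleC_scaleC mult.commute)
  moreover have "g - complex_of_real \<kappa> *\<^sub>C h \<in> Domain main"
    using r(2) by (simp add: g_def h_def scaleC_scaleC main mult.assoc)
  ultimately show "\<exists>gp gm. adapted_pair S main gp gm \<kappa>"
    using \<kappa> by (auto simp: adapted_pair_def normalized_pair_def main_parameter_def)
  assume pair: "adapted_pair S main gp gm \<kappa>'"
  then have \<kappa>': "0 \<le> \<kappa>'" and n: "norm gp = 1" "norm gm = 1"
    and dom: "gp - complex_of_real \<kappa>' *\<^sub>C gm \<in> Domain main"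
    by (auto simp: adapted_pair_def normalized_pair_def main_parameter_def)
  obtain \<alpha> \<beta> where ab: "gp = \<alpha> *\<^sub>C e" "gm = \<beta> *\<^sub>C d"
    using pair e_mult d_mult unfolding adapted_pair_def normalized_pair_def by metis
  have nab: "cmod \<alpha> = cmod \<beta>" "cmod \<beta> \<noteq> 0"
  proof -
    have 1: "cmod \<alpha> * sqrt a = 1" "cmod \<beta> * sqrt a = 1"
      using n by (simp_all add: ab norm_scaleC norms)
    then have "cmod \<alpha> * sqrt a = cmod \<beta> * sqrt a" by simp
    then show "cmod \<alpha> = cmod \<beta>" using a by simp
    show "cmod \<beta> \<noteq> 0" using 1(2) by auto
  qed
  have rel: "\<alpha> * x = \<kappa>' * \<beta> * y"
    using dom by (simp add: ab scaleC_scaleC main)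
  \<comment> \<open>Taking moduli removes the phases of the pair. The relation itself still fixes
    the ratio of \<open>\<alpha>\<close> to \<open>\<beta>\<close>, and with it
    \<open>U\<close>.\<close>
  have "\<kappa>' = \<kappa>"
    using arg_cong[OF rel, of cmod] nab mod' \<kappa>' xy by (simp add: norm_mult)
  moreover have "x * (\<alpha> + U * \<beta>) = 0"
    using rel[unfolded \<open>\<kappa>' = \<kappa>\<close>] Ux by algebra
  ultimately show "\<kappa>' = \<kappa> \<and> self_adjoint_parameter A0 gp gm U"
    using xy cU by (simp add: self_adjoint_parameter_def ab scaleC_scaleC A0)
qed

end

section \<open>Realization of the shifted impedance function\<close>

theorem theorem37:
  fixes \<Theta>0 :: "'h::complex_hilbert_space l_system"
    and \<kappa>0 Q :: real
  assumes "0 \<le> \<kappa>0" and "\<kappa>0 < 1"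
    and "is_l_system \<Theta>0"
    and "impedance \<Theta>0 \<in> class_M_inv \<kappa>0"
    and "Q \<noteq> 0"
  shows
    "let a = (1 + \<kappa>0) / (1 - \<kappa>0);
         b = Q\<^sup>2 + a\<^sup>2 - 1;
         s = sqrt (b\<^sup>2 + 4 * Q\<^sup>2);
         \<kappa> = (a * (b + s)\<^sup>2 - (b - 2 * Q\<^sup>2 + s)\<^sup>2 - 4 * Q\<^sup>2 * a * (a - 1)) /
             ((b - 2 * Q\<^sup>2 + s)\<^sup>2 + a * (b + s)\<^sup>2 + 4 * Q\<^sup>2 * a * (a + 1));
         U = ((complex_of_real a + complex_of_real Q * \<i>) * (1 - (complex_of_real \<kappa>)\<^sup>2)
               - 1 - (complex_of_real \<kappa>)\<^sup>2) / (2 * complex_of_real \<kappa>)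
     in \<exists>\<Theta>Q :: 'h l_system.
          is_l_system \<Theta>Q \<and> \<Theta>Q \<noteq> \<Theta>0 \<and> sym_op \<Theta>Q = sym_op \<Theta>0 \<and>
          resolvent_set (quasi_kernel \<Theta>Q) = resolvent_set (quasi_kernel \<Theta>0) \<and>
          (\<forall>z \<in> resolvent_set (quasi_kernel \<Theta>0).
             impedance \<Theta>Q z = complex_of_real Q + impedance \<Theta>0 z) \<and>
          (\<exists>gp gm. adapted_pair (sym_op \<Theta>Q) (main_op \<Theta>Q) gp gm \<kappa>) \<and>
          (\<forall>gp gm \<kappa>'. adapted_pair (sym_op \<Theta>Q) (main_op \<Theta>Q) gp gm \<kappa>' \<longrightarrow>
             \<kappa>' = \<kappa> \<and> self_adjoint_parameter (quasi_kernel \<Theta>Q) gp gm U)"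
proof -
  define a where "a = (1 + \<kappa>0) / (1 - \<kappa>0)"
  define S where "S = sym_op \<Theta>0"
  define \<Gamma>1 where "\<Gamma>1 = adj_K (channel_op \<Theta>0)"
  have a: "1 \<le> a" using assms(1,2) by (simp add: a_def field_simps)
  obtain \<Gamma>0 where triple: "boundary_triple S \<Gamma>0 \<Gamma>1" "boundary_triple.realized_by S \<Gamma>0 \<Gamma>1 \<Theta>0"
    using l_system_boundary_triple[OF assms(3)] unfolding S_def \<Gamma>1_def by blast
  interpret T: boundary_triple S \<Gamma>0 \<Gamma>1 by (rule triple(1))
  interpret N: boundary_triple S \<Gamma>0 "\<lambda>f. \<Gamma>1 f + complex_of_real Q * \<Gamma>0 f"
    by (rule T.shifted_triple)
  have prime: "prime_op S"
    using assms(3) by (simp add: is_l_system_def admissible_symmetric_def S_def)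
  \<comment> \<open>The restriction to the kernel of \<open>\<Gamma>0\<close> is the same for both
    triples, hence a common quasi-kernel.\<close>
  have qk: "quasi_kernel \<Theta>0 = T.A0" "quasi_kernel N.system = T.A0"
    by (rule T.quasi_kernel_realized[OF triple(2)] N.quasi_kernel_realized[OF N.realized_by_system])+
  have imp: "impedance N.system z = complex_of_real Q + impedance \<Theta>0 z"
    if f: "f \<in> ker_shift (adj_op S) z" "\<Gamma>0 f = 1" and inj: "\<And>u. (u, z *\<^sub>C u) \<in> T.A0 \<Longrightarrow> u = 0" for f z
    using T.impedance_eqI[OF triple(2) f inj] N.impedance_eqI[OF N.realized_by_system f inj] f(2)
    by (simp add: add.commute)
  obtain e where e: "e \<in> ker_shift (adj_op S) \<i>" "\<Gamma>0 e = 1"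
    by (rule T.deficiency_vector[of \<i>]) auto
  have inj_i: "u = 0" if "(u, \<i> *\<^sub>C u) \<in> T.A0" for u
    by (rule T.nonreal_not_eigenvalue[OF _ that]) simp
  have "\<Gamma>1 e = \<i> * a"
    using T.impedance_eqI[OF triple(2) e inj_i] class_M_inv_at_ii[OF assms(4,1,2)]
    by (simp add: a_def)
  then have e_val: "\<Gamma>1 e + complex_of_real Q * \<Gamma>0 e = Q + \<i> * a"
    by (simp add: e(2))
  \<comment> \<open>The modulus of \<open>(1 - a + \<i> * Q) / (1 + a + \<i> * Q)\<close>: positive
    because \<open>Q \<noteq> 0\<close>, below one because \<open>a > 0\<close>.\<close>
  define \<kappa> where "\<kappa> = sqrt (((a - 1)\<^sup>2 + Q\<^sup>2) / ((a + 1)\<^sup>2 + Q\<^sup>2))"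
  have Q2: "0 < Q\<^sup>2" using assms(5) by simp
  have pos: "0 < (a - 1)\<^sup>2 + Q\<^sup>2" "0 < (a + 1)\<^sup>2 + Q\<^sup>2"
    using Q2 by (simp_all add: add_nonneg_pos)
  have "(a - 1)\<^sup>2 + Q\<^sup>2 < (a + 1)\<^sup>2 + Q\<^sup>2"
    using a by (simp add: power2_eq_square algebra_simps)
  then have \<kappa>: "0 < \<kappa>" "\<kappa> < 1"
    using pos by (simp_all add: \<kappa>_def)
  have mod: "cmod (complex_of_real (1 - a) + \<i> * Q) = \<kappa> * cmod (complex_of_real (1 + a) + \<i> * Q)"
    using pos assms(5) by (simp add: cmod_def \<kappa>_def real_sqrt_divide power2_commute[of 1 a] add.commute)
  note params = N.main_parameters[OF e e_val _ assms(5) \<kappa> mod]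
  have "0 < a" using a by simp
  \<comment> \<open>The impedance functions differ by \<open>Q \<noteq> 0\<close> at the point
    \<open>\<i>\<close>.\<close>
  have "N.system \<noteq> \<Theta>0"
    using imp[OF e inj_i] assms(5) by auto
  moreover have "impedance N.system z = complex_of_real Q + impedance \<Theta>0 z"
    if z: "z \<in> resolvent_set T.A0" for z
  proof -
    obtain f where "f \<in> ker_shift (adj_op S) z" "\<Gamma>0 f = 1"
      by (rule T.resolvent_set_vector[OF z])
    then show ?thesis
      by (rule imp) (rule T.resolvent_set_not_eigenvalue[OF z])
  qed
  moreover have "sym_op N.system = S" "main_op N.system = N.main"
    by (simp_all add: N.system_def)
  ultimately show ?thesis
    unfolding Let_def a_def[symmetric] kappa_closed_form[OF a assms(5)] \<kappa>_def[symmetric]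
      S_def[symmetric] qk(1)
    using params[OF \<open>0 < a\<close>] N.is_l_system_system[OF prime] qk(2)
    by (intro exI[of _ N.system]) (simp only:, blast)
qed

end
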